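(* Let $R$ be a commutative ring with $R=2R$, and let $I$ be an ideal of $R$. Let $(P,\langle\,,\rangle)$ be a symplectic $R$-module with $P$ a finitely generated projective module of rank $2n$, $n\ge1$, and let $Q=R^2\oplus P$ with its induced form. Assume that for every maximal ideal $\mathfrak m$ of $R$, over the local ring $R_{\mathfrak m}$ the form $\langle\,,\rangle$ corresponds (w.r.t. some basis of $P_{\mathfrak m}$) to an alternating matrix $\varphi_{\mathfrak m}$ with $\varphi_{\mathfrak m}\equiv\psi_n \pmod I$. Then $$\mathrm{Trans}_{\mathrm{Sp}}(Q,IQ,\langle\,,\rangle)=\mathrm{ETrans}_{\mathrm{Sp}}(Q,IQ,\langle\,,\rangle).$$
   Context: A symplectic $R$-module is a pair $(P,\langle\,,\rangle)$ with $P$ finitely generated projective of even rank and $\langle\,,\rangle:P\times P\to R$ a non-degenerate (i.e. $x\mapsto\langle x,-\rangle$ is an isomorphism $P\cong P^*$) alternating bilinear form. $Q=R^2\oplus P$ carries the form $\langle(a,b,p),(a',b',p')\rangle=ab'-ba'+\langle p,p'\rangle$, and is itself a symplectic module. An element $q$ of a module $M$ is unimodular if $\phi(q)=1$ for some $\phi\in M^*=\mathrm{Hom}_R(M,R)$. A symplectic transvection of a symplectic module $S$ is an automorphism $\sigma(p)=p+\langle u,p\rangle v+\langle v,p\rangle u+\alpha\langle u,p\rangle u$, with $\alpha\in R$, $u,v\in S$, $\langle u,v\rangle=0$ and $u$ or $v$ unimodular. $\mathrm{Trans}_{\mathrm{Sp}}(S,IS,\langle\,,\rangle)$ is the group generated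 by the symplectic transvections of this form with $\alpha\in I$, $u\in S$, $v\in IS$. The elementary symplectic transvections of $Q$ are $\rho(q,\alpha):(a,b,p)\mapsto(a,\,b-\langle p,q\rangle-\alpha a,\,p-aq)$ and $\mu(q,\beta):(a,b,p)\mapsto(a+\langle p,q\rangle+\beta b,\,b,\,p-bq)$, with $q\in P$, $\alpha,\beta\in R$. $\mathrm{ETrans}_{\mathrm{Sp}}(Q,\langle\,,\rangle)$ is the group they generate; $\mathrm{ETrans}_{\mathrm{Sp}}(IQ,\langle\,,\rangle)$ is the subgroup generated by those with $q\in IP$, $\alpha,\beta\in I$; $\mathrm{ETrans}_{\mathrm{Sp}}(Q,IQ,\langle\,,\rangle)$ is the normal closure of the latter in the former. A form corresponds to the matrix $\varphi$ w.r.t. a basis if $\langle p,q\rangle=p\varphi q^t$ in row coordinates; by convention such matrices have Pfaffian $1$. $\psi_n=\sum_{i=1}^n e_{2i-1,2i}-\sum_{i=1}^n e_{2i,2i-1}$. The congruence mod $I$ over $R_{\mathfrak m}$ is modulo $IR_{\mathfrak m}$. *)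

theory Defs
  imports "HOL-Algebra.Algebra" "HOL-Combinatorics.Permutations"
begin

section \<open>Modules\<close>

text \<open>
  The record type of modules extends that of rings, so every module record carries the fields
  \<open>mult\<close> and \<open>one\<close>; the locale \<open>module\<close> does not mention them and they are left unspecified below.
\<close>

definition self_module :: "('a, 'm) ring_scheme \<Rightarrow> ('a, 'a) module" where
  "self_module R = \<lparr>carrier = carrier R, monoid.mult = undefined, one = undefined,
     ring.zero = \<zero>\<^bsub>R\<^esub>, ring.add = (\<lambda>x y. x \<oplus>\<^bsub>R\<^esub> y), module.smult = (\<lambda>a x. a \<otimes>\<^bsub>R\<^esub> x)\<rparr>"

definition direct_sum ::
    "('a, 'b, 'm) module_scheme \<Rightarrow> ('a, 'c, 'n) module_scheme \<Rightarrow> ('a, 'b \<times> 'c) module" where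
  "direct_sum M N = \<lparr>carrier = carrier M \<times> carrier N, monoid.mult = undefined, one = undefined,
     ring.zero = (\<zero>\<^bsub>M\<^esub>, \<zero>\<^bsub>N\<^esub>),
     ring.add = (\<lambda>(x, y) (x', y'). (x \<oplus>\<^bsub>M\<^esub> x', y \<oplus>\<^bsub>N\<^esub> y')),
     module.smult = (\<lambda>a (x, y). (a \<odot>\<^bsub>M\<^esub> x, a \<odot>\<^bsub>N\<^esub> y))\<rparr>"

definition free_module :: "('a, 'm) ring_scheme \<Rightarrow> nat \<Rightarrow> ('a, nat \<Rightarrow> 'a) module" where
  "free_module R k = \<lparr>carrier = {1..k} \<rightarrow>\<^sub>E carrier R, monoid.mult = undefined, one = undefined,
     ring.zero = (\<lambda>i\<in>{1..k}. \<zero>\<^bsub>R\<^esub>),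
     ring.add = (\<lambda>x y. \<lambda>i\<in>{1..k}. x i \<oplus>\<^bsub>R\<^esub> y i),
     module.smult = (\<lambda>a x. \<lambda>i\<in>{1..k}. a \<otimes>\<^bsub>R\<^esub> x i)\<rparr>"

definition mod_hom ::
    "('a, 'l) ring_scheme \<Rightarrow> ('a, 'b, 'm) module_scheme \<Rightarrow> ('a, 'c, 'n) module_scheme \<Rightarrow> ('b \<Rightarrow> 'c) set" where
  "mod_hom R M N = {f \<in> carrier M \<rightarrow> carrier N.
     (\<forall>x\<in>carrier M. \<forall>y\<in>carrier M. f (x \<oplus>\<^bsub>M\<^esub> y) = f x \<oplus>\<^bsub>N\<^esub> f y) \<and>
     (\<forall>a\<in>carrier R. \<forall>x\<in>carrier M. f (a \<odot>\<^bsub>M\<^esub> x) = a \<odot>\<^bsub>N\<^esub> f x)}"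

definition mod_iso ::
    "('a, 'l) ring_scheme \<Rightarrow> ('a, 'b, 'm) module_scheme \<Rightarrow> ('a, 'c, 'n) module_scheme \<Rightarrow> ('b \<Rightarrow> 'c) set" where
  "mod_iso R M N = {f \<in> mod_hom R M N. bij_betw f (carrier M) (carrier N)}"

text \<open>Elements of the dual are extensional, so that equal linear forms are equal as functions.\<close>

definition dual_module ::
    "('a, 'l) ring_scheme \<Rightarrow> ('a, 'b, 'm) module_scheme \<Rightarrow> ('a, 'b \<Rightarrow> 'a) module" where
  "dual_module R M = \<lparr>carrier = mod_hom R M (self_module R) \<inter> extensional (carrier M),
     monoid.mult = undefined, one = undefined,
     ring.zero = (\<lambda>x\<in>carrier M. \<zero>\<^bsub>R\<^esub>),
     ring.add = (\<lambda>f g. \<lambda>x\<in>carrier M. f x \<oplus>\<^bsub>R\<^esub> g x),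
     module.smult = (\<lambda>a f. \<lambda>x\<in>carrier M. a \<otimes>\<^bsub>R\<^esub> f x)\<rparr>"

definition unimodular :: "('a, 'l) ring_scheme \<Rightarrow> ('a, 'b, 'm) module_scheme \<Rightarrow> 'b \<Rightarrow> bool" where
  "unimodular R M q \<longleftrightarrow> (\<exists>f\<in>mod_hom R M (self_module R). f q = \<one>\<^bsub>R\<^esub>)"

text \<open>
  Finitely generated projective: a direct summand of some \<open>R\<^sup>k\<close>. A complement embeds into
  \<open>R\<^sup>k\<close>, so the fixed element type of the complement is no restriction.
\<close>

definition fg_projective :: "('a, 'l) ring_scheme \<Rightarrow> ('a, 'b, 'm) module_scheme \<Rightarrow> bool" where
  "fg_projective R M \<longleftrightarrow> module R M \<and>
     (\<exists>k (N :: ('a, nat \<Rightarrow> 'a) module). module R N \<and>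
        mod_iso R (direct_sum M N) (free_module R k) \<noteq> {})"

definition mod_basis ::
    "('a, 'l) ring_scheme \<Rightarrow> ('a, 'b, 'm) module_scheme \<Rightarrow> nat \<Rightarrow> (nat \<Rightarrow> 'b) \<Rightarrow> bool" where
  "mod_basis R M d e \<longleftrightarrow> e \<in> {1..d} \<rightarrow> carrier M \<and>
     (\<forall>x\<in>carrier M. \<exists>!c. c \<in> {1..d} \<rightarrow>\<^sub>E carrier R \<and> x = (\<Oplus>\<^bsub>M\<^esub>i\<in>{1..d}. c i \<odot>\<^bsub>M\<^esub> e i))"

text \<open>\<open>IM\<close>: the finite sums of products \<open>i x\<close> with \<open>i \<in> I\<close> and \<open>x \<in> M\<close>.\<close>

definition ideal_smult :: "('a, 'b, 'm) module_scheme \<Rightarrow> 'a set \<Rightarrow> 'b set" where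
  "ideal_smult M I = generate (add_monoid M) {i \<odot>\<^bsub>M\<^esub> x | i x. i \<in> I \<and> x \<in> carrier M}"


section \<open>Localization\<close>

text \<open>
  For a multiplicative set \<open>S\<close>, the fraction \<open>x/s\<close> is the class of \<open>(x, s)\<close> under
  \<open>(x, s) \<sim> (y, t) \<longleftrightarrow> w (t x) = w (s y)\<close> for some \<open>w \<in> S\<close>. Operations on classes are
  unions over all representatives; all members of such a union coincide.
\<close>

definition loc_rel ::
    "('a, 'b, 'm) module_scheme \<Rightarrow> 'a set \<Rightarrow> (('b \<times> 'a) \<times> ('b \<times> 'a)) set" where
  "loc_rel M S = {((x, s), (y, t)). x \<in> carrier M \<and> s \<in> S \<and> y \<in> carrier M \<and> t \<in> S \<and>
     (\<exists>w\<in>S. w \<odot>\<^bsub>M\<^esub> (t \<odot>\<^bsub>M\<^esub> x) = w \<odot>\<^bsub>M\<^esub> (s \<odot>\<^bsub>M\<^esub> y))}"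

definition loc_frac :: "('a, 'b, 'm) module_scheme \<Rightarrow> 'a set \<Rightarrow> 'b \<Rightarrow> 'a \<Rightarrow> ('b \<times> 'a) set" where
  "loc_frac M S x s = loc_rel M S `` {(x, s)}"

definition loc_module ::
    "('a, 'l) ring_scheme \<Rightarrow> ('a, 'b, 'm) module_scheme \<Rightarrow> 'a set
      \<Rightarrow> (('a \<times> 'a) set, ('b \<times> 'a) set) module" where
  "loc_module R M S = \<lparr>carrier = (carrier M \<times> S) // loc_rel M S,
     monoid.mult = undefined, one = undefined,
     ring.zero = loc_frac M S \<zero>\<^bsub>M\<^esub> \<one>\<^bsub>R\<^esub>,
     ring.add = (\<lambda>U V. \<Union>(x, s)\<in>U. \<Union>(y, t)\<in>V. loc_frac M S (t \<odot>\<^bsub>M\<^esub> x \<oplus>\<^bsub>M\<^esub> s \<odot>\<^bsub>M\<^esub> y) (s \<otimes>\<^bsub>R\<^esub> t)),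
     module.smult = (\<lambda>A U. \<Union>(a, r)\<in>A. \<Union>(x, s)\<in>U. loc_frac M S (a \<odot>\<^bsub>M\<^esub> x) (r \<otimes>\<^bsub>R\<^esub> s))\<rparr>"

definition loc_ring :: "('a, 'l) ring_scheme \<Rightarrow> 'a set \<Rightarrow> ('a \<times> 'a) set ring" where
  "loc_ring R S = (let L = loc_module R (self_module R) S in
     \<lparr>carrier = carrier L, monoid.mult = (\<lambda>U V. U \<odot>\<^bsub>L\<^esub> V), one = loc_frac (self_module R) S \<one>\<^bsub>R\<^esub> \<one>\<^bsub>R\<^esub>,
      ring.zero = \<zero>\<^bsub>L\<^esub>, ring.add = (\<lambda>U V. U \<oplus>\<^bsub>L\<^esub> V)\<rparr>)"

text \<open>The extended form: \<open>\<langle>x/s, y/t\<rangle> = \<langle>x, y\<rangle>/(st)\<close>.\<close>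

definition loc_form ::
    "('a, 'l) ring_scheme \<Rightarrow> 'a set \<Rightarrow> ('b \<Rightarrow> 'b \<Rightarrow> 'a)
      \<Rightarrow> ('b \<times> 'a) set \<Rightarrow> ('b \<times> 'a) set \<Rightarrow> ('a \<times> 'a) set" where
  "loc_form R S B U V =
     (\<Union>(x, s)\<in>U. \<Union>(y, t)\<in>V. loc_frac (self_module R) S (B x y) (s \<otimes>\<^bsub>R\<^esub> t))"

text \<open>The extended ideal \<open>S\<^sup>-\<^sup>1I\<close>, generated by the image of \<open>I\<close>.\<close>

definition loc_ideal :: "('a, 'l) ring_scheme \<Rightarrow> 'a set \<Rightarrow> 'a set \<Rightarrow> ('a \<times> 'a) set set" where
  "loc_ideal R S I = genideal (loc_ring R S) ((\<lambda>i. loc_frac (self_module R) S i \<one>\<^bsub>R\<^esub>) ` I)"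

abbreviation ring_at :: "('a, 'l) ring_scheme \<Rightarrow> 'a set \<Rightarrow> ('a \<times> 'a) set ring" where
  "ring_at R \<pp> \<equiv> loc_ring R (carrier R - \<pp>)"

abbreviation module_at ::
    "('a, 'l) ring_scheme \<Rightarrow> ('a, 'b, 'm) module_scheme \<Rightarrow> 'a set
      \<Rightarrow> (('a \<times> 'a) set, ('b \<times> 'a) set) module" where
  "module_at R M \<pp> \<equiv> loc_module R M (carrier R - \<pp>)"

abbreviation form_at ::
    "('a, 'l) ring_scheme \<Rightarrow> ('b \<Rightarrow> 'b \<Rightarrow> 'a) \<Rightarrow> 'a set
      \<Rightarrow> ('b \<times> 'a) set \<Rightarrow> ('b \<times> 'a) set \<Rightarrow> ('a \<times> 'a) set" where
  "form_at R B \<pp> \<equiv> loc_form R (carrier R - \<pp>) B"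

abbreviation ideal_at :: "('a, 'l) ring_scheme \<Rightarrow> 'a set \<Rightarrow> 'a set \<Rightarrow> ('a \<times> 'a) set set" where
  "ideal_at R I \<pp> \<equiv> loc_ideal R (carrier R - \<pp>) I"

definition has_rank :: "('a, 'l) ring_scheme \<Rightarrow> ('a, 'b, 'm) module_scheme \<Rightarrow> nat \<Rightarrow> bool" where
  "has_rank R M d \<longleftrightarrow>
     (\<forall>\<pp>. primeideal \<pp> R \<longrightarrow> (\<exists>e. mod_basis (ring_at R \<pp>) (module_at R M \<pp>) d e))"


section \<open>Symplectic modules\<close>

definition alternating_bilinear ::
    "('a, 'l) ring_scheme \<Rightarrow> ('a, 'b, 'm) module_scheme \<Rightarrow> ('b \<Rightarrow> 'b \<Rightarrow> 'a) \<Rightarrow> bool" where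
  "alternating_bilinear R M B \<longleftrightarrow>
     (\<forall>x\<in>carrier M. (\<lambda>y. B x y) \<in> mod_hom R M (self_module R)) \<and>
     (\<forall>y\<in>carrier M. (\<lambda>x. B x y) \<in> mod_hom R M (self_module R)) \<and>
     (\<forall>x\<in>carrier M. B x x = \<zero>\<^bsub>R\<^esub>)"

definition nondegenerate ::
    "('a, 'l) ring_scheme \<Rightarrow> ('a, 'b, 'm) module_scheme \<Rightarrow> ('b \<Rightarrow> 'b \<Rightarrow> 'a) \<Rightarrow> bool" where
  "nondegenerate R M B \<longleftrightarrow> (\<lambda>x. \<lambda>y\<in>carrier M. B x y) \<in> mod_iso R M (dual_module R M)"

definition symplectic_module ::
    "('a, 'l) ring_scheme \<Rightarrow> ('a, 'b, 'm) module_scheme \<Rightarrow> ('b \<Rightarrow> 'b \<Rightarrow> 'a) \<Rightarrow> bool" where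
  "symplectic_module R M B \<longleftrightarrow> fg_projective R M \<and> (\<exists>n. has_rank R M (2 * n)) \<and>
     alternating_bilinear R M B \<and> nondegenerate R M B"

text \<open>\<open>Q = R\<^sup>2 \<oplus> P\<close>, with elements written \<open>(a, b, p)\<close>.\<close>

definition hyp_module ::
    "('a, 'l) ring_scheme \<Rightarrow> ('a, 'b, 'm) module_scheme \<Rightarrow> ('a, 'a \<times> 'a \<times> 'b) module" where
  "hyp_module R P = direct_sum (self_module R) (direct_sum (self_module R) P)"

definition hyp_form ::
    "('a, 'l) ring_scheme \<Rightarrow> ('b \<Rightarrow> 'b \<Rightarrow> 'a) \<Rightarrow> 'a \<times> 'a \<times> 'b \<Rightarrow> 'a \<times> 'a \<times> 'b \<Rightarrow> 'a" where
  "hyp_form R B = (\<lambda>(a, b, p) (a', b', p').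
     (a \<otimes>\<^bsub>R\<^esub> b' \<ominus>\<^bsub>R\<^esub> b \<otimes>\<^bsub>R\<^esub> a') \<oplus>\<^bsub>R\<^esub> B p p')"


section \<open>Matrices of forms\<close>

text \<open>Matrices of size \<open>d\<close> are functions of two indices in \<open>{1..d}\<close>; other values are irrelevant.\<close>

definition form_matrix ::
    "('a, 'l) ring_scheme \<Rightarrow> ('a, 'b, 'm) module_scheme \<Rightarrow> ('b \<Rightarrow> 'b \<Rightarrow> 'a)
      \<Rightarrow> nat \<Rightarrow> (nat \<Rightarrow> 'b) \<Rightarrow> (nat \<Rightarrow> nat \<Rightarrow> 'a) \<Rightarrow> bool" where
  "form_matrix R M B d e A \<longleftrightarrow>
     (\<forall>x \<in> {1..d} \<rightarrow> carrier R. \<forall>y \<in> {1..d} \<rightarrow> carrier R.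
        B (\<Oplus>\<^bsub>M\<^esub>i\<in>{1..d}. x i \<odot>\<^bsub>M\<^esub> e i) (\<Oplus>\<^bsub>M\<^esub>j\<in>{1..d}. y j \<odot>\<^bsub>M\<^esub> e j)
          = (\<Oplus>\<^bsub>R\<^esub>i\<in>{1..d}. \<Oplus>\<^bsub>R\<^esub>j\<in>{1..d}. x i \<otimes>\<^bsub>R\<^esub> A i j \<otimes>\<^bsub>R\<^esub> y j))"

definition alternating_matrix ::
    "('a, 'l) ring_scheme \<Rightarrow> nat \<Rightarrow> (nat \<Rightarrow> nat \<Rightarrow> 'a) \<Rightarrow> bool" where
  "alternating_matrix R d A \<longleftrightarrow>
     (\<forall>i\<in>{1..d}. \<forall>j\<in>{1..d}. A i j \<in> carrier R \<and> A j i = \<ominus>\<^bsub>R\<^esub> A i j) \<and>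
     (\<forall>i\<in>{1..d}. A i i = \<zero>\<^bsub>R\<^esub>)"

text \<open>
  Pfaffian of an alternating matrix of size \<open>2n\<close>: the signed sum over the perfect matchings
  \<open>{\<sigma>(1), \<sigma>(2)}, \<dots>, {\<sigma>(2n-1), \<sigma>(2n)}\<close> of \<open>{1..2n}\<close>, each represented by the unique \<open>\<sigma>\<close>
  with \<open>\<sigma>(2i-1) < \<sigma>(2i)\<close> and \<open>\<sigma>(1) < \<sigma>(3) < \<dots> < \<sigma>(2n-1)\<close>.
\<close>

definition matching_perms :: "nat \<Rightarrow> (nat \<Rightarrow> nat) set" where
  "matching_perms n = {\<sigma>. \<sigma> permutes {1..2 * n} \<and>
     (\<forall>i\<in>{1..n}. \<sigma> (2 * i - 1) < \<sigma> (2 * i)) \<and>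
     (\<forall>i\<in>{1..<n}. \<sigma> (2 * i - 1) < \<sigma> (2 * i + 1))}"

definition pfaffian :: "('a, 'l) ring_scheme \<Rightarrow> nat \<Rightarrow> (nat \<Rightarrow> nat \<Rightarrow> 'a) \<Rightarrow> 'a" where
  "pfaffian R n A = (\<Oplus>\<^bsub>R\<^esub>\<sigma>\<in>matching_perms n.
     [sign \<sigma>] \<cdot>\<^bsub>R\<^esub> (\<Otimes>\<^bsub>R\<^esub>i\<in>{1..n}. A (\<sigma> (2 * i - 1)) (\<sigma> (2 * i))))"

definition psi_matrix :: "('a, 'l) ring_scheme \<Rightarrow> nat \<Rightarrow> nat \<Rightarrow> nat \<Rightarrow> 'a" where
  "psi_matrix R n i j =
     (if \<exists>k\<in>{1..n}. i = 2 * k - 1 \<and> j = 2 * k then \<one>\<^bsub>R\<^esub>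
      else if \<exists>k\<in>{1..n}. i = 2 * k \<and> j = 2 * k - 1 then \<ominus>\<^bsub>R\<^esub> \<one>\<^bsub>R\<^esub>
      else \<zero>\<^bsub>R\<^esub>)"

definition matrix_cong ::
    "('a, 'l) ring_scheme \<Rightarrow> 'a set \<Rightarrow> nat \<Rightarrow> (nat \<Rightarrow> nat \<Rightarrow> 'a) \<Rightarrow> (nat \<Rightarrow> nat \<Rightarrow> 'a) \<Rightarrow> bool" where
  "matrix_cong R J d A A' \<longleftrightarrow> (\<forall>i\<in>{1..d}. \<forall>j\<in>{1..d}. A i j \<ominus>\<^bsub>R\<^esub> A' i j \<in> J)"


section \<open>Transvection groups\<close>

text \<open>Automorphisms are extensional functions, as in \<^const>\<open>BijGroup\<close>.\<close>

definition aut_group ::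
    "('a, 'l) ring_scheme \<Rightarrow> ('a, 'b, 'm) module_scheme \<Rightarrow> ('b \<Rightarrow> 'b) monoid" where
  "aut_group R M = BijGroup (carrier M)
     \<lparr>carrier := mod_iso R M M \<inter> extensional (carrier M)\<rparr>"

definition sp_transvection ::
    "('a, 'l) ring_scheme \<Rightarrow> ('a, 'b, 'm) module_scheme \<Rightarrow> ('b \<Rightarrow> 'b \<Rightarrow> 'a)
      \<Rightarrow> 'b \<Rightarrow> 'b \<Rightarrow> 'a \<Rightarrow> 'b \<Rightarrow> 'b" where
  "sp_transvection R M B u v \<alpha> = (\<lambda>p\<in>carrier M.
     p \<oplus>\<^bsub>M\<^esub> B u p \<odot>\<^bsub>M\<^esub> v \<oplus>\<^bsub>M\<^esub> B v p \<odot>\<^bsub>M\<^esub> u \<oplus>\<^bsub>M\<^esub> (\<alpha> \<otimes>\<^bsub>R\<^esub> B u p) \<odot>\<^bsub>M\<^esub> u)"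

definition Trans_Sp ::
    "('a, 'l) ring_scheme \<Rightarrow> ('a, 'b, 'm) module_scheme \<Rightarrow> ('b \<Rightarrow> 'b \<Rightarrow> 'a) \<Rightarrow> 'a set
      \<Rightarrow> ('b \<Rightarrow> 'b) set" where
  "Trans_Sp R M B I = generate (aut_group R M)
     {sp_transvection R M B u v \<alpha> | u v \<alpha>.
        \<alpha> \<in> I \<and> u \<in> carrier M \<and> v \<in> ideal_smult M I \<and> B u v = \<zero>\<^bsub>R\<^esub> \<and>
        (unimodular R M u \<or> unimodular R M v)}"

definition elem_rho ::
    "('a, 'l) ring_scheme \<Rightarrow> ('a, 'b, 'm) module_scheme \<Rightarrow> ('b \<Rightarrow> 'b \<Rightarrow> 'a)
      \<Rightarrow> 'b \<Rightarrow> 'a \<Rightarrow> 'a \<times> 'a \<times> 'b \<Rightarrow> 'a \<times> 'a \<times> 'b" where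
  "elem_rho R P B q \<alpha> = (\<lambda>(a, b, p) \<in> carrier (hyp_module R P).
     (a, b \<ominus>\<^bsub>R\<^esub> B p q \<ominus>\<^bsub>R\<^esub> \<alpha> \<otimes>\<^bsub>R\<^esub> a, p \<ominus>\<^bsub>P\<^esub> a \<odot>\<^bsub>P\<^esub> q))"

definition elem_mu ::
    "('a, 'l) ring_scheme \<Rightarrow> ('a, 'b, 'm) module_scheme \<Rightarrow> ('b \<Rightarrow> 'b \<Rightarrow> 'a)
      \<Rightarrow> 'b \<Rightarrow> 'a \<Rightarrow> 'a \<times> 'a \<times> 'b \<Rightarrow> 'a \<times> 'a \<times> 'b" where
  "elem_mu R P B q \<beta> = (\<lambda>(a, b, p) \<in> carrier (hyp_module R P).
     (a \<oplus>\<^bsub>R\<^esub> B p q \<oplus>\<^bsub>R\<^esub> \<beta> \<otimes>\<^bsub>R\<^esub> b, b, p \<ominus>\<^bsub>P\<^esub> b \<odot>\<^bsub>P\<^esub> q))"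

text \<open>
  These groups act on \<open>Q = hyp_module R P\<close> but take \<open>P\<close> and its form as arguments, since the
  elementary generators depend on the decomposition \<open>Q = R\<^sup>2 \<oplus> P\<close>.
  \<open>ETrans_Sp\<close> is \<open>ETrans(Q)\<close>, \<open>ETrans_Sp_ideal\<close> is \<open>ETrans(IQ)\<close>, \<open>ETrans_Sp_rel\<close> is \<open>ETrans(Q, IQ)\<close>.
\<close>

definition ETrans_Sp ::
    "('a, 'l) ring_scheme \<Rightarrow> ('a, 'b, 'm) module_scheme \<Rightarrow> ('b \<Rightarrow> 'b \<Rightarrow> 'a)
      \<Rightarrow> ('a \<times> 'a \<times> 'b \<Rightarrow> 'a \<times> 'a \<times> 'b) set" where
  "ETrans_Sp R P B = generate (aut_group R (hyp_module R P))
     ({elem_rho R P B q \<alpha> | q \<alpha>. q \<in> carrier P \<and> \<alpha> \<in> carrier R} \<union>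
      {elem_mu R P B q \<beta> | q \<beta>. q \<in> carrier P \<and> \<beta> \<in> carrier R})"

definition ETrans_Sp_ideal ::
    "('a, 'l) ring_scheme \<Rightarrow> ('a, 'b, 'm) module_scheme \<Rightarrow> ('b \<Rightarrow> 'b \<Rightarrow> 'a) \<Rightarrow> 'a set
      \<Rightarrow> ('a \<times> 'a \<times> 'b \<Rightarrow> 'a \<times> 'a \<times> 'b) set" where
  "ETrans_Sp_ideal R P B I = generate (aut_group R (hyp_module R P))
     ({elem_rho R P B q \<alpha> | q \<alpha>. q \<in> ideal_smult P I \<and> \<alpha> \<in> I} \<union>
      {elem_mu R P B q \<beta> | q \<beta>. q \<in> ideal_smult P I \<and> \<beta> \<in> I})"

definition normal_closure :: "('g, 'm) monoid_scheme \<Rightarrow> 'g set \<Rightarrow> 'g set" where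
  "normal_closure G H = \<Inter>{N. N \<lhd> G \<and> H \<subseteq> N}"

definition ETrans_Sp_rel ::
    "('a, 'l) ring_scheme \<Rightarrow> ('a, 'b, 'm) module_scheme \<Rightarrow> ('b \<Rightarrow> 'b \<Rightarrow> 'a) \<Rightarrow> 'a set
      \<Rightarrow> ('a \<times> 'a \<times> 'b \<Rightarrow> 'a \<times> 'a \<times> 'b) set" where
  "ETrans_Sp_rel R P B I =
     normal_closure (aut_group R (hyp_module R P)\<lparr>carrier := ETrans_Sp R P B\<rparr>) (ETrans_Sp_ideal R P B I)"

end

theory Submission
  imports Defs
begin

text \<open>
  Write \<open>T u v \<alpha>\<close> for the transvection \<open>x \<mapsto> x + \<langle>u,x\<rangle>v + \<langle>v,x\<rangle>u + \<alpha>\<langle>u,x\<rangle>u\<close> and let \<open>e\<close>, \<open>f\<close> be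
  the hyperbolic pair of \<open>Q = R\<^sup>2 \<oplus> P\<close>. The elementary transvections are the \<open>T e p \<alpha>\<close> and \<open>T f p \<alpha>\<close>
  with \<open>p \<in> P\<close>, and isometries permute transvections by conjugation. So \<open>ETrans(IQ)\<close> lies in
  \<open>Trans(Q,IQ)\<close>, which every isometry normalizes; this gives \<open>ETrans(Q,IQ) \<subseteq> Trans(Q,IQ)\<close>.

  For the other inclusion, let \<open>N\<close> be normal in \<open>ETrans(Q)\<close> and contain \<open>ETrans(IQ)\<close>. The core is that
  \<open>N\<close> contains every transvection \<open>T x 0 c : y \<mapsto> y + c\<langle>x,y\<rangle>x\<close> with \<open>x \<in> Q\<close> and \<open>c \<in> I\<close>
  (\<open>rank_one_transvection\<close>). Write \<open>x = h + p\<close> with \<open>h\<close> in the hyperbolic plane and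
  \<open>p \<in> P\<close>. As \<open>h\<close> and \<open>p\<close> span an isotropic submodule, \<open>T x 0 c\<close> is the product of \<open>T h 0 c\<close>, \<open>T p 0 c\<close>
  and \<open>T h (cp) 0\<close>. The factor for \<open>p\<close> appears when an elementary transvection that sends \<open>f\<close> to
  \<open>f + p\<close> conjugates \<open>T f 0 c\<close>; the mixed factor splits into elementary ones up to transvections along \<open>p\<close>.
  The factor for \<open>h\<close> comes from commutators: that of \<open>T h q 0\<close> and \<open>T h (cp) 0\<close> is
  \<open>T h 0 (2c\<langle>q,p\<rangle>)\<close>. Now 2 is a unit, and the values of the form generate the unit ideal because \<open>P\<close> has
  positive rank (\<open>form_ideal_of_positive_rank\<close>).

  Polarization then produces all generators of \<open>Trans(Q,IQ)\<close>: if \<open>\<langle>u,w\<rangle> = 0\<close>, then \<open>T u (cw) c\<close> is the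
  quotient of \<open>T (u+w) 0 c\<close> by \<open>T w 0 c\<close>. If \<open>u\<close> is unimodular, say \<open>\<langle>u,y\<rangle> = 1\<close>, the projection
  \<open>v \<mapsto> v - \<langle>u,v\<rangle>y\<close> shows that every \<open>v \<in> IQ\<close> orthogonal to \<open>u\<close> is a sum of products \<open>cw\<close> with \<open>c \<in> I\<close>
  and \<open>w\<close> orthogonal to \<open>u\<close>. If instead \<open>v \<in> IQ\<close> is unimodular, then \<open>I = R\<close> and \<open>c = 1\<close> is available
  (\<open>transvection_in_normal\<close>).
\<close>

section \<open>Products of an ideal and a module\<close>

context module
begin

lemma ideal_smult_zero: "\<zero>\<^bsub>M\<^esub> \<in> ideal_smult M J"
  using generate.one[of "add_monoid M"] by (simp add: ideal_smult_def)

lemma ideal_smult_mult: "c \<in> J \<Longrightarrow> x \<in> carrier M \<Longrightarrow> c \<odot>\<^bsub>M\<^esub> x \<in> ideal_smult M J"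
  unfolding ideal_smult_def by (rule generate.incl) auto

lemma ideal_smult_add:
  "x \<in> ideal_smult M J \<Longrightarrow> y \<in> ideal_smult M J \<Longrightarrow> x \<oplus>\<^bsub>M\<^esub> y \<in> ideal_smult M J"
  using generate.eng[of _ "add_monoid M"] by (simp add: ideal_smult_def)

text \<open>
  The module \<open>JM\<close> is defined as a generated group; the inverse of a generator \<open>c x\<close> is the generator
  \<open>(-c) x\<close>, so sums of generators suffice.
\<close>
lemma ideal_smult_induct [consumes 2, case_names zero scaled add]:
  assumes J: "ideal J R" and v: "v \<in> ideal_smult M J"
    and zero: "Pr \<zero>\<^bsub>M\<^esub>"
    and scaled: "\<And>c x. c \<in> J \<Longrightarrow> x \<in> carrier M \<Longrightarrow> Pr (c \<odot>\<^bsub>M\<^esub> x)"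
    and add: "\<And>x y. \<lbrakk>x \<in> ideal_smult M J; y \<in> ideal_smult M J; Pr x; Pr y\<rbrakk> \<Longrightarrow> Pr (x \<oplus>\<^bsub>M\<^esub> y)"
  shows "Pr v"
  using v[unfolded ideal_smult_def]
proof induction
  case one
  then show ?case
    using zero by simp
next
  case (incl h)
  then show ?case
    using scaled by auto
next
  case (inv h)
  then obtain c x where "h = c \<odot>\<^bsub>M\<^esub> x" "c \<in> J" "x \<in> carrier M"
    by auto
  moreover have "\<ominus> c \<in> J" "c \<in> carrier R" if "c \<in> J" for c
    using that J additive_subgroup.a_inv_closed[OF ideal.axioms(1)] ideal.Icarr by metis+
  ultimately show ?case
    using scaled[of "\<ominus> c" x] by (simp add: a_inv_def[symmetric] smult_l_minus)
next
  case (eng h k)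
  then show ?case
    using add[of h k, unfolded ideal_smult_def] by simp
qed

lemma ideal_smult_carrier:
  assumes "ideal J R" and "v \<in> ideal_smult M J"
  shows "v \<in> carrier M"
  using assms by (induction rule: ideal_smult_induct) (auto intro: ideal.Icarr[OF assms(1)])

end

lemma (in group) subgroup_mem_factor:
  assumes "subgroup N G" "x \<in> carrier G" "y \<in> carrier G" "x \<otimes> y \<in> N"
  shows "x \<in> N \<Longrightarrow> y \<in> N" and "y \<in> N \<Longrightarrow> x \<in> N"
proof -
  have "inv x \<otimes> (x \<otimes> y) = y" "(x \<otimes> y) \<otimes> inv y = x"
    using assms by (simp_all add: m_assoc[symmetric]) (simp add: m_assoc)
  then show "x \<in> N \<Longrightarrow> y \<in> N" "y \<in> N \<Longrightarrow> x \<in> N"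
    using assms by (metis subgroup.m_closed subgroup.m_inv_closed)+
qed

section \<open>Alternating forms and symplectic transvections\<close>

locale alternating_module = module R M for R (structure) and M (structure) +
  fixes B :: "'c \<Rightarrow> 'c \<Rightarrow> 'a"
  assumes alternating: "alternating_bilinear R M B"
begin

abbreviation "T \<equiv> sp_transvection R M B"

abbreviation "A \<equiv> aut_group R M"

lemma form_closed [simp]: "x \<in> carrier M \<Longrightarrow> y \<in> carrier M \<Longrightarrow> B x y \<in> carrier R"
  using alternating by (auto simp: alternating_bilinear_def mod_hom_def self_module_def Pi_iff)

lemma form_add_left [simp]:
    "\<lbrakk>x \<in> carrier M; y \<in> carrier M; z \<in> carrier M\<rbrakk> \<Longrightarrow> B (x \<oplus>\<^bsub>M\<^esub> y) z = B x z \<oplus> B y z"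
  and form_add_right [simp]:
    "\<lbrakk>x \<in> carrier M; y \<in> carrier M; z \<in> carrier M\<rbrakk> \<Longrightarrow> B z (x \<oplus>\<^bsub>M\<^esub> y) = B z x \<oplus> B z y"
  and form_smult_left [simp]:
    "\<lbrakk>a \<in> carrier R; x \<in> carrier M; z \<in> carrier M\<rbrakk> \<Longrightarrow> B (a \<odot>\<^bsub>M\<^esub> x) z = a \<otimes> B x z"
  and form_smult_right [simp]:
    "\<lbrakk>a \<in> carrier R; x \<in> carrier M; z \<in> carrier M\<rbrakk> \<Longrightarrow> B z (a \<odot>\<^bsub>M\<^esub> x) = a \<otimes> B z x"
  and form_self [simp]: "x \<in> carrier M \<Longrightarrow> B x x = \<zero>"
  using alternating by (auto simp: alternating_bilinear_def mod_hom_def self_module_def)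

lemma form_zero_left [simp]: "x \<in> carrier M \<Longrightarrow> B \<zero>\<^bsub>M\<^esub> x = \<zero>"
  using form_smult_left[of \<zero> "\<zero>\<^bsub>M\<^esub>" x] by (simp del: form_smult_left)

lemma form_zero_right [simp]: "x \<in> carrier M \<Longrightarrow> B x \<zero>\<^bsub>M\<^esub> = \<zero>"
  using form_smult_right[of \<zero> "\<zero>\<^bsub>M\<^esub>" x] by (simp del: form_smult_right)

lemma form_skew:
  assumes "x \<in> carrier M" "y \<in> carrier M"
  shows "B y x = \<ominus> B x y"
proof -
  have "B (x \<oplus>\<^bsub>M\<^esub> y) (x \<oplus>\<^bsub>M\<^esub> y) = \<zero>"
    using assms by (intro form_self) simp
  then have "B y x \<oplus> B x y = \<zero>"
    using assms form_self[of x] form_self[of y] by (simp del: form_self)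
  then show ?thesis
    using assms by (simp add: R.minus_equality)
qed

lemma form_minus_left [simp]:
  "x \<in> carrier M \<Longrightarrow> y \<in> carrier M \<Longrightarrow> B (\<ominus>\<^bsub>M\<^esub> x) y = \<ominus> B x y"
  using form_add_left[of "\<ominus>\<^bsub>M\<^esub> x" x y] by (metis M.a_inv_closed M.l_neg R.minus_equality form_closed form_zero_left)

lemma form_minus_right [simp]:
  "x \<in> carrier M \<Longrightarrow> y \<in> carrier M \<Longrightarrow> B y (\<ominus>\<^bsub>M\<^esub> x) = \<ominus> B y x"
  by (metis M.a_inv_closed form_minus_left form_skew)

lemma transvection_apply:
  "x \<in> carrier M \<Longrightarrow> T u v \<alpha> x =
     x \<oplus>\<^bsub>M\<^esub> B u x \<odot>\<^bsub>M\<^esub> v \<oplus>\<^bsub>M\<^esub> B v x \<odot>\<^bsub>M\<^esub> u \<oplus>\<^bsub>M\<^esub> (\<alpha> \<otimes> B u x) \<odot>\<^bsub>M\<^esub> u"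
  by (simp add: sp_transvection_def)

lemma transvection_closed [simp]:
  "\<lbrakk>u \<in> carrier M; v \<in> carrier M; \<alpha> \<in> carrier R; x \<in> carrier M\<rbrakk> \<Longrightarrow> T u v \<alpha> x \<in> carrier M"
  by (simp add: transvection_apply)

lemmas module_simps = smult_l_distr smult_r_distr smult_assoc1[symmetric] R.l_distr R.r_distr
  R.m_ac R.a_ac M.a_ac

lemma transvection_id: "u \<in> carrier M \<Longrightarrow> T u \<zero>\<^bsub>M\<^esub> \<zero> = (\<lambda>x\<in>carrier M. x)"
  by (auto simp: sp_transvection_def fun_eq_iff)

text \<open>The correction \<open>B v w\<close> makes the transvections along \<open>u\<close> a group of Heisenberg type.\<close>
lemma transvection_compose:
  assumes "u \<in> carrier M" "v \<in> carrier M" "w \<in> carrier M" "\<alpha> \<in> carrier R" "\<beta> \<in> carrier R"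
    and "B u v = \<zero>" "B u w = \<zero>"
  shows "compose (carrier M) (T u v \<alpha>) (T u w \<beta>) = T u (v \<oplus>\<^bsub>M\<^esub> w) (\<alpha> \<oplus> \<beta> \<oplus> B v w)"
proof
  fix x
  show "compose (carrier M) (T u v \<alpha>) (T u w \<beta>) x = T u (v \<oplus>\<^bsub>M\<^esub> w) (\<alpha> \<oplus> \<beta> \<oplus> B v w) x"
  proof (cases "x \<in> carrier M")
    case True
    moreover have "B v u = \<zero>"
      using assms form_skew[of u v] by simp
    ultimately show ?thesis
      using assms by (simp add: compose_def transvection_apply module_simps)
  qed (simp add: compose_def sp_transvection_def)
qed

lemma transvection_hom:
  assumes "u \<in> carrier M" "v \<in> carrier M" "\<alpha> \<in> carrier R"
  shows "T u v \<alpha> \<in> mod_hom R M M"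
  using assms by (auto simp: mod_hom_def transvection_apply module_simps)

lemma transvection_iso:
  assumes "u \<in> carrier M" "v \<in> carrier M" "\<alpha> \<in> carrier R" "B u v = \<zero>"
  shows "T u v \<alpha> \<in> mod_iso R M M"
proof -
  have 1: "compose (carrier M) (T u v \<alpha>) (T u (\<ominus>\<^bsub>M\<^esub> v) (\<ominus> \<alpha>)) = (\<lambda>x\<in>carrier M. x)"
    using assms by (simp add: transvection_compose M.r_neg R.r_neg transvection_id)
  have 2: "compose (carrier M) (T u (\<ominus>\<^bsub>M\<^esub> v) (\<ominus> \<alpha>)) (T u v \<alpha>) = (\<lambda>x\<in>carrier M. x)"
    using assms by (simp add: transvection_compose M.l_neg R.l_neg transvection_id)
  have "T u v \<alpha> (T u (\<ominus>\<^bsub>M\<^esub> v) (\<ominus> \<alpha>) x) = x" "T u (\<ominus>\<^bsub>M\<^esub> v) (\<ominus> \<alpha>) (T u v \<alpha> x) = x"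
    if "x \<in> carrier M" for x
    using that fun_cong[OF 1, of x] fun_cong[OF 2, of x] by (simp_all add: compose_def)
  then have "bij_betw (T u v \<alpha>) (carrier M) (carrier M)"
    using assms by (intro bij_betw_byWitness[where f' = "T u (\<ominus>\<^bsub>M\<^esub> v) (\<ominus> \<alpha>)"]) auto
  then show ?thesis
    using assms by (simp add: mod_iso_def transvection_hom)
qed

lemma aut_carrier: "carrier A = mod_iso R M M \<inter> extensional (carrier M)"
  and aut_one: "\<one>\<^bsub>A\<^esub> = (\<lambda>x\<in>carrier M. x)"
  by (simp_all add: aut_group_def BijGroup_def)

lemma autD:
  assumes "g \<in> carrier A"
  shows "\<And>x. x \<in> carrier M \<Longrightarrow> g x \<in> carrier M"
    and "\<And>x y. x \<in> carrier M \<Longrightarrow> y \<in> carrier M \<Longrightarrow> g (x \<oplus>\<^bsub>M\<^esub> y) = g x \<oplus>\<^bsub>M\<^esub> g y"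
    and "\<And>a x. a \<in> carrier R \<Longrightarrow> x \<in> carrier M \<Longrightarrow> g (a \<odot>\<^bsub>M\<^esub> x) = a \<odot>\<^bsub>M\<^esub> g x"
    and "bij_betw g (carrier M) (carrier M)"
    and "g \<in> extensional (carrier M)"
  using assms by (auto simp: aut_carrier mod_iso_def mod_hom_def)

lemma aut_in_Bij: "g \<in> carrier A \<Longrightarrow> g \<in> Bij (carrier M)"
  by (simp add: Bij_def autD)

lemma aut_mult:
  assumes "g \<in> carrier A" "h \<in> carrier A"
  shows "g \<otimes>\<^bsub>A\<^esub> h = compose (carrier M) g h"
proof -
  have "g \<in> Bij (carrier M)" "h \<in> Bij (carrier M)"
    using assms by (simp_all only: aut_in_Bij)
  then show ?thesis
    by (simp add: aut_group_def BijGroup_def)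
qed

lemma aut_subgroup: "subgroup (mod_iso R M M \<inter> extensional (carrier M)) (BijGroup (carrier M))"
proof (rule group.subgroupI[OF group_BijGroup])
  have in_Bij: "f \<in> Bij (carrier M)" if "f \<in> mod_iso R M M \<inter> extensional (carrier M)" for f
    using that by (auto simp: Bij_def mod_iso_def)
  then show "mod_iso R M M \<inter> extensional (carrier M) \<subseteq> carrier (BijGroup (carrier M))"
    by (auto simp: BijGroup_def)
  have "(\<lambda>x\<in>carrier M. x) \<in> mod_iso R M M"
    using transvection_id[of "\<zero>\<^bsub>M\<^esub>"] transvection_iso[of "\<zero>\<^bsub>M\<^esub>" "\<zero>\<^bsub>M\<^esub>" \<zero>] by simp
  then show "mod_iso R M M \<inter> extensional (carrier M) \<noteq> {}"
    by auto
  fix f assume f: "f \<in> mod_iso R M M \<inter> extensional (carrier M)"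
  define g where "g = inv_into (carrier M) f"
  have bij: "bij_betw f (carrier M) (carrier M)"
    and hom: "\<And>x y. x \<in> carrier M \<Longrightarrow> y \<in> carrier M \<Longrightarrow> f (x \<oplus>\<^bsub>M\<^esub> y) = f x \<oplus>\<^bsub>M\<^esub> f y"
      "\<And>a x. a \<in> carrier R \<Longrightarrow> x \<in> carrier M \<Longrightarrow> f (a \<odot>\<^bsub>M\<^esub> x) = a \<odot>\<^bsub>M\<^esub> f x"
    using f by (auto simp: mod_iso_def mod_hom_def)
  have closed: "g x \<in> carrier M" and fg: "f (g x) = x" if "x \<in> carrier M" for x
    using that bij unfolding g_def
    by (metis bij_betw_imp_surj_on inv_into_into, metis bij_betw_inv_into_right)
  have gf: "g (f x) = x" if "x \<in> carrier M" for x
    using that bij unfolding g_def by (metis bij_betw_inv_into_left)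
  have "g (x \<oplus>\<^bsub>M\<^esub> y) = g x \<oplus>\<^bsub>M\<^esub> g y" if "x \<in> carrier M" "y \<in> carrier M" for x y
    using gf[of "g x \<oplus>\<^bsub>M\<^esub> g y"] that by (simp add: hom closed fg)
  moreover have "g (a \<odot>\<^bsub>M\<^esub> x) = a \<odot>\<^bsub>M\<^esub> g x" if "a \<in> carrier R" "x \<in> carrier M" for a x
    using gf[of "a \<odot>\<^bsub>M\<^esub> g x"] that by (simp add: hom closed fg)
  moreover have "bij_betw (restrict g (carrier M)) (carrier M) (carrier M)"
    using bij_betw_inv_into[OF bij] by (simp add: g_def bij_betw_def inj_on_def)
  ultimately have "restrict g (carrier M) \<in> mod_iso R M M"
    using closed by (simp add: mod_iso_def mod_hom_def)
  then show "inv\<^bsub>BijGroup (carrier M)\<^esub> f \<in> mod_iso R M M \<inter> extensional (carrier M)"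
    using inv_BijGroup[OF in_Bij[OF f]] by (simp add: g_def)
  fix h assume h: "h \<in> mod_iso R M M \<inter> extensional (carrier M)"
  have "bij_betw (compose (carrier M) f h) (carrier M) (carrier M)"
    using f h by (auto simp: mod_iso_def intro: bij_betw_compose)
  then have "compose (carrier M) f h \<in> mod_iso R M M"
    using f h by (auto simp: mod_iso_def mod_hom_def compose_def Pi_iff)
  then show "f \<otimes>\<^bsub>BijGroup (carrier M)\<^esub> h \<in> mod_iso R M M \<inter> extensional (carrier M)"
    using in_Bij[OF f] in_Bij[OF h] by (simp add: BijGroup_def)
qed

sublocale Aut: group A
  unfolding aut_group_def by (rule subgroup.subgroup_is_group[OF aut_subgroup group_BijGroup])

lemma transvection_aut:
  "\<lbrakk>u \<in> carrier M; v \<in> carrier M; \<alpha> \<in> carrier R; B u v = \<zero>\<rbrakk> \<Longrightarrow> T u v \<alpha> \<in> carrier A"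
  unfolding aut_carrier using transvection_iso by (simp add: sp_transvection_def)

lemma transvection_mult:
  assumes "u \<in> carrier M" "v \<in> carrier M" "w \<in> carrier M" "\<alpha> \<in> carrier R" "\<beta> \<in> carrier R"
    and "B u v = \<zero>" "B u w = \<zero>"
  shows "T u v \<alpha> \<otimes>\<^bsub>A\<^esub> T u w \<beta> = T u (v \<oplus>\<^bsub>M\<^esub> w) (\<alpha> \<oplus> \<beta> \<oplus> B v w)"
  using assms by (simp add: aut_mult transvection_aut transvection_compose)

lemma transvection_commute:
  assumes "u \<in> carrier M" "v \<in> carrier M"
  shows "T u v \<zero> = T v u \<zero>"
  using assms by (auto simp: sp_transvection_def fun_eq_iff M.a_ac)

lemma transvection_smult:
  assumes "u \<in> carrier M" "v \<in> carrier M" "r \<in> carrier R" "\<alpha> \<in> carrier R"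
  shows "T (r \<odot>\<^bsub>M\<^esub> u) v \<alpha> = T u (r \<odot>\<^bsub>M\<^esub> v) (r \<otimes> r \<otimes> \<alpha>)"
  using assms by (auto simp: sp_transvection_def fun_eq_iff module_simps)

text \<open>
  Polarization of the rank one transvections. It expresses \<open>T u (c w) c\<close> through transvections along
  single vectors, and also peels off the summands of a vector with orthogonal components.
\<close>
lemma transvection_split:
  assumes "u \<in> carrier M" "w \<in> carrier M" "c \<in> carrier R" "B u w = \<zero>"
  shows "T (u \<oplus>\<^bsub>M\<^esub> w) \<zero>\<^bsub>M\<^esub> c = T u (c \<odot>\<^bsub>M\<^esub> w) c \<otimes>\<^bsub>A\<^esub> T w \<zero>\<^bsub>M\<^esub> c"
proof -
  have "B w u = \<zero>"
    using assms form_skew[of u w] by simp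
  then show ?thesis
    using assms
    by (simp add: aut_mult transvection_aut)
      (simp add: compose_def sp_transvection_def fun_eq_iff module_simps)
qed

definition isometries :: "('c \<Rightarrow> 'c) set" where
  "isometries = {g \<in> carrier A. \<forall>x\<in>carrier M. \<forall>y\<in>carrier M. B (g x) (g y) = B x y}"

lemma isometries_subgroup: "subgroup isometries A"
proof (rule Aut.subgroupI)
  show "isometries \<subseteq> carrier A"
    by (auto simp: isometries_def)
  have "\<one>\<^bsub>A\<^esub> \<in> isometries"
    using Aut.one_closed by (simp add: isometries_def aut_one)
  then show "isometries \<noteq> {}"
    by auto
  fix g assume g: "g \<in> isometries"
  have i: "inv\<^bsub>A\<^esub> g \<in> carrier A" and gA: "g \<in> carrier A"
    using g by (auto simp: isometries_def)
  have "compose (carrier M) g (inv\<^bsub>A\<^esub> g) = (\<lambda>x\<in>carrier M. x)"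
    using Aut.r_inv[OF gA] i gA by (simp add: aut_mult aut_one)
  then have g_inv: "g ((inv\<^bsub>A\<^esub> g) x) = x" if "x \<in> carrier M" for x
    using that by (metis compose_eq restrict_apply')
  have "B (g x) (g y) = B x y" if "x \<in> carrier M" "y \<in> carrier M" for x y
    using g that by (simp add: isometries_def)
  then have "B ((inv\<^bsub>A\<^esub> g) x) ((inv\<^bsub>A\<^esub> g) y) = B x y" if "x \<in> carrier M" "y \<in> carrier M" for x y
    using that autD(1)[OF i] g_inv by metis
  then show "inv\<^bsub>A\<^esub> g \<in> isometries"
    using i by (simp add: isometries_def)
  fix h assume h: "h \<in> isometries"
  then have hA: "h \<in> carrier A"
    by (auto simp: isometries_def)
  have "(g \<otimes>\<^bsub>A\<^esub> h) x = g (h x)" if "x \<in> carrier M" for x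
    using that aut_mult[OF gA hA] by (simp add: compose_def)
  moreover have "g \<otimes>\<^bsub>A\<^esub> h \<in> carrier A"
    using gA hA by (rule Aut.m_closed)
  ultimately show "g \<otimes>\<^bsub>A\<^esub> h \<in> isometries"
    using g h autD(1)[OF hA] by (simp add: isometries_def)
qed

lemma transvection_isometry:
  assumes "u \<in> carrier M" "v \<in> carrier M" "\<alpha> \<in> carrier R" "B u v = \<zero>"
  shows "T u v \<alpha> \<in> isometries"
proof -
  have vu: "B v u = \<zero>"
    using assms form_skew[of u v] by simp
  have "B (T u v \<alpha> x) (T u v \<alpha> y) = B x y" if "x \<in> carrier M" "y \<in> carrier M" for x y
  proof -
    have s: "B x u = \<ominus> B u x" "B x v = \<ominus> B v x"
      using that assms by (auto intro: form_skew)
    have closed: "B x y \<in> carrier R" "B u x \<in> carrier R" "B v x \<in> carrier R" "B u y \<in> carrier R" "B v y \<in> carrier R"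
      using that assms by auto
    have "B u (T u v \<alpha> y) = B u y" "B v (T u v \<alpha> y) = B v y"
      using that assms vu by (simp_all add: transvection_apply)
    then have "B (T u v \<alpha> x) (T u v \<alpha> y) =
        B x (T u v \<alpha> y) \<oplus> B u x \<otimes> B v y \<oplus> B v x \<otimes> B u y \<oplus> \<alpha> \<otimes> B u x \<otimes> B u y"
      using that assms by (simp add: transvection_apply[of x])
    also have "B x (T u v \<alpha> y) = B x y \<oplus> B u y \<otimes> \<ominus> B v x \<oplus> B v y \<otimes> \<ominus> B u x \<oplus> \<alpha> \<otimes> B u y \<otimes> \<ominus> B u x"
      using that assms s by (simp add: transvection_apply[of y])
    also have "\<dots> \<oplus> B u x \<otimes> B v y \<oplus> B v x \<otimes> B u y \<oplus> \<alpha> \<otimes> B u x \<otimes> B u y = B x y"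
      using closed assms(3) by algebra
    finally show ?thesis .
  qed
  then show ?thesis
    using assms by (simp add: isometries_def transvection_aut)
qed

lemma transvection_conj:
  assumes "g \<in> isometries" "u \<in> carrier M" "v \<in> carrier M" "\<alpha> \<in> carrier R" "B u v = \<zero>"
  shows "g \<otimes>\<^bsub>A\<^esub> T u v \<alpha> \<otimes>\<^bsub>A\<^esub> inv\<^bsub>A\<^esub> g = T (g u) (g v) \<alpha>"
proof -
  have g: "g \<in> carrier A" and iso: "\<And>x y. x \<in> carrier M \<Longrightarrow> y \<in> carrier M \<Longrightarrow> B (g x) (g y) = B x y"
    using assms(1) by (auto simp: isometries_def)
  note gM = autD(1-3)[OF g]
  have T': "T (g u) (g v) \<alpha> \<in> carrier A"
    using assms gM iso by (simp add: transvection_aut)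
  have "compose (carrier M) g (T u v \<alpha>) = compose (carrier M) (T (g u) (g v) \<alpha>) g"
    using assms gM iso by (auto simp: compose_def fun_eq_iff transvection_apply)
  then have "g \<otimes>\<^bsub>A\<^esub> T u v \<alpha> = T (g u) (g v) \<alpha> \<otimes>\<^bsub>A\<^esub> g"
    using g T' assms by (simp add: aut_mult transvection_aut)
  then show ?thesis
    using g T' by (simp add: Aut.m_assoc)
qed

lemma transvection_parallel:
  assumes "u \<in> carrier M" "c \<in> carrier R"
  shows "T u (c \<odot>\<^bsub>M\<^esub> u) \<zero> = T u \<zero>\<^bsub>M\<^esub> (c \<oplus> c)"
  using assms by (auto simp: sp_transvection_def fun_eq_iff module_simps)

lemma mod_hom_ideal_smult:
  assumes J: "ideal J R" and g: "g \<in> mod_hom R M (self_module R)" and v: "v \<in> ideal_smult M J"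
  shows "g v \<in> J"
proof -
  interpret J: ideal J R by (rule J)
  have g_add: "g (x \<oplus>\<^bsub>M\<^esub> y) = g x \<oplus> g y" and g_R: "g x \<in> carrier R"
    and g_smult: "a \<in> carrier R \<Longrightarrow> g (a \<odot>\<^bsub>M\<^esub> x) = a \<otimes> g x"
    if "x \<in> carrier M" "y \<in> carrier M" for x y a
    using g that by (auto simp: mod_hom_def self_module_def)
  from J v show ?thesis
  proof (induction rule: ideal_smult_induct)
    case zero
    show ?case
      using g_smult[of "\<zero>\<^bsub>M\<^esub>" "\<zero>\<^bsub>M\<^esub>" \<zero>] g_R[of "\<zero>\<^bsub>M\<^esub>" "\<zero>\<^bsub>M\<^esub>"] by simp
  next
    case (scaled c x)
    then show ?case
      using g_smult g_R J.I_r_closed J.Icarr by simp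
  next
    case (add x y)
    then show ?case
      using g_add ideal_smult_carrier[OF J] by simp
  qed
qed

lemma form_ideal_smult:
  assumes J: "ideal J R" and "v \<in> ideal_smult M J" "x \<in> carrier M"
  shows "B v x \<in> J"
  using mod_hom_ideal_smult[OF J _ assms(2), of "\<lambda>y. B y x"] alternating assms(3)
  by (simp add: alternating_bilinear_def)

lemma ideal_smult_hom:
  assumes J: "ideal J R" and g: "g \<in> carrier A" and v: "v \<in> ideal_smult M J"
  shows "g v \<in> ideal_smult M J"
  using J v
proof (induction rule: ideal_smult_induct)
  case zero
  show ?case
    using autD(3)[OF g, of \<zero> "\<zero>\<^bsub>M\<^esub>"] autD(1)[OF g, of "\<zero>\<^bsub>M\<^esub>"] ideal_smult_zero by simp
next
  case (scaled c x)
  then show ?case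
    using autD(1,3)[OF g] ideal.Icarr[OF J] by (simp add: ideal_smult_mult)
next
  case (add x y)
  then show ?case
    using autD(2)[OF g] ideal_smult_carrier[OF J] by (simp add: ideal_smult_add)
qed

lemma unimodular_image:
  assumes g: "g \<in> carrier A" and u: "u \<in> carrier M" "unimodular R M u"
  shows "unimodular R M (g u)"
proof -
  obtain \<phi> where \<phi>: "\<phi> \<in> mod_hom R M (self_module R)" "\<phi> u = \<one>"
    using u by (auto simp: unimodular_def)
  let ?k = "inv\<^bsub>A\<^esub> g"
  have k: "?k \<in> carrier A"
    using g by simp
  have "compose (carrier M) ?k g = (\<lambda>x\<in>carrier M. x)"
    using Aut.l_inv[OF g] aut_mult[OF k g] aut_one by simp
  then have "?k (g u) = u"
    using u(1) by (metis compose_eq restrict_apply')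
  moreover have "(\<lambda>x. \<phi> (?k x)) \<in> mod_hom R M (self_module R)"
    using \<phi>(1) autD(1-3)[OF k] by (auto simp: mod_hom_def Pi_iff)
  ultimately show ?thesis
    using \<phi>(2) unfolding unimodular_def by (intro bexI[of _ "\<lambda>x. \<phi> (?k x)"]) auto
qed

text \<open>
  Conjugating \<open>T u v \<alpha>\<close> by an isometry \<open>g\<close> gives \<open>T (g u) (g v) \<alpha>\<close>, and the conditions on \<open>u\<close> and
  \<open>v\<close> are invariant under isometries.
\<close>
lemma Trans_Sp_normal:
  assumes "ideal J R"
  shows "Trans_Sp R M B J \<lhd> A\<lparr>carrier := isometries\<rparr>"
proof -
  let ?S = "{T u v \<alpha> | u v \<alpha>. \<alpha> \<in> J \<and> u \<in> carrier M \<and> v \<in> ideal_smult M J \<and> B u v = \<zero> \<and>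
        (unimodular R M u \<or> unimodular R M v)}"
  let ?G = "A\<lparr>carrier := isometries\<rparr>"
  interpret G: group ?G
    by (rule Aut.subgroup_imp_group[OF isometries_subgroup])
  have S: "?S \<subseteq> isometries"
    using ideal_smult_carrier[OF assms] ideal.Icarr[OF assms] by (auto intro!: transvection_isometry)
  have "generate ?G ?S \<lhd> ?G"
  proof (rule G.normal_generateI)
    show "?S \<subseteq> carrier ?G"
      using S by simp
    fix t g assume t: "t \<in> ?S" and "g \<in> carrier ?G"
    then have g: "g \<in> isometries" and gA: "g \<in> carrier A"
      by (auto simp: isometries_def)
    obtain u v \<alpha> where uv: "t = T u v \<alpha>" "\<alpha> \<in> J" "u \<in> carrier M" "v \<in> ideal_smult M J" "B u v = \<zero>"
        "unimodular R M u \<or> unimodular R M v"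
      using t by auto
    have vM: "v \<in> carrier M" and \<alpha>R: "\<alpha> \<in> carrier R"
      using uv ideal_smult_carrier[OF assms] ideal.Icarr[OF assms] by auto
    have "g \<otimes>\<^bsub>?G\<^esub> t \<otimes>\<^bsub>?G\<^esub> inv\<^bsub>?G\<^esub> g = T (g u) (g v) \<alpha>"
      using transvection_conj[OF g uv(3) vM \<alpha>R uv(5)] Aut.m_inv_consistent[OF isometries_subgroup g] uv(1)
      by simp
    moreover have "B (g u) (g v) = \<zero>"
      using g uv vM by (simp add: isometries_def)
    moreover have "g v \<in> ideal_smult M J" "g u \<in> carrier M"
      using ideal_smult_hom[OF assms gA uv(4)] autD(1)[OF gA uv(3)] by auto
    moreover have "unimodular R M (g u) \<or> unimodular R M (g v)"
      using unimodular_image[OF gA] uv(3,6) vM by auto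
    ultimately show "g \<otimes>\<^bsub>?G\<^esub> t \<otimes>\<^bsub>?G\<^esub> inv\<^bsub>?G\<^esub> g \<in> ?S"
      using uv(2) by auto
  qed
  then show ?thesis
    unfolding Trans_Sp_def using Aut.generate_consistent[OF S isometries_subgroup] by simp
qed

end

section \<open>Normal subgroups containing the elementary transvections\<close>

locale hyperbolic_pair = alternating_module +
  fixes e f
  assumes e_closed [simp]: "e \<in> carrier M" and f_closed [simp]: "f \<in> carrier M"
    and form_e_f [simp]: "B e f = \<one>"
begin

definition complement where
  "complement = {p \<in> carrier M. B e p = \<zero> \<and> B f p = \<zero>}"

text \<open>
  The case \<open>J = R\<close> is that of all elementary transvections relative to the plane of \<open>e\<close> and \<open>f\<close>. In general
  the vector is a single product \<open>c p\<close>, because that is the shape in which it arises from conjugation.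
\<close>
definition elementary_in where
  "elementary_in J S \<longleftrightarrow> (\<forall>p\<in>complement. \<forall>c\<in>J. \<forall>d\<in>J.
     T e (c \<odot>\<^bsub>M\<^esub> p) d \<in> S \<and> T f (c \<odot>\<^bsub>M\<^esub> p) d \<in> S)"

lemma form_f_e [simp]: "B f e = \<ominus> \<one>"
  using form_skew[of e f] by simp

lemma complementD:
  assumes "p \<in> complement"
  shows "p \<in> carrier M" "B e p = \<zero>" "B f p = \<zero>" "B p e = \<zero>" "B p f = \<zero>"
  using assms form_skew[of e p] form_skew[of f p] by (auto simp: complement_def)

lemma hyperbolic_decomposition:
  assumes "x \<in> carrier M"
  obtains a b p where "a \<in> carrier R" "b \<in> carrier R" "p \<in> complement"
    "x = (a \<odot>\<^bsub>M\<^esub> e \<oplus>\<^bsub>M\<^esub> b \<odot>\<^bsub>M\<^esub> f) \<oplus>\<^bsub>M\<^esub> p"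
proof
  let ?h = "B x f \<odot>\<^bsub>M\<^esub> e \<oplus>\<^bsub>M\<^esub> B e x \<odot>\<^bsub>M\<^esub> f"
  show "B x f \<in> carrier R" "B e x \<in> carrier R"
    using assms by auto
  show "\<ominus>\<^bsub>M\<^esub> ?h \<oplus>\<^bsub>M\<^esub> x \<in> complement"
    using assms form_skew[of f x] by (simp add: complement_def R.l_neg R.r_neg R.r_minus)
  show "x = ?h \<oplus>\<^bsub>M\<^esub> (\<ominus>\<^bsub>M\<^esub> ?h \<oplus>\<^bsub>M\<^esub> x)"
    using assms by (simp add: M.r_neg2)
qed

end

text \<open>
  With \<open>N = E\<close> and \<open>J = R\<close> every result about \<open>N\<close> becomes a result about \<open>E\<close> itself.
\<close>
locale elementary_normal = hyperbolic_pair +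
  fixes E N J
  assumes J_ideal: "ideal J R"
    and E_subgroup: "subgroup E A" and N_subgroup: "subgroup N A"
    and N_conj: "\<And>g x. g \<in> E \<Longrightarrow> x \<in> N \<Longrightarrow> g \<otimes>\<^bsub>A\<^esub> x \<otimes>\<^bsub>A\<^esub> inv\<^bsub>A\<^esub> g \<in> N"
    and E_elementary: "elementary_in (carrier R) E" and N_elementary: "elementary_in J N"
begin

lemma J_closed [simp]:
  shows "c \<in> J \<Longrightarrow> c \<in> carrier R"
    and "\<lbrakk>c \<in> J; r \<in> carrier R\<rbrakk> \<Longrightarrow> c \<otimes> r \<in> J" "\<lbrakk>c \<in> J; r \<in> carrier R\<rbrakk> \<Longrightarrow> r \<otimes> c \<in> J"
    and "\<lbrakk>c \<in> J; d \<in> J\<rbrakk> \<Longrightarrow> c \<oplus> d \<in> J" and "c \<in> J \<Longrightarrow> \<ominus> c \<in> J" and "\<zero> \<in> J"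
  using J_ideal by (auto simp: ideal.Icarr ideal.I_l_closed ideal.I_r_closed
      additive_subgroup.a_closed[OF ideal.axioms(1)] additive_subgroup.a_inv_closed[OF ideal.axioms(1)]
      additive_subgroup.zero_closed[OF ideal.axioms(1)])

lemma N_mult: "x \<in> N \<Longrightarrow> y \<in> N \<Longrightarrow> x \<otimes>\<^bsub>A\<^esub> y \<in> N"
  by (rule subgroup.m_closed[OF N_subgroup])

lemma elementary_transvections:
  assumes "p \<in> complement" "c \<in> J" "d \<in> J"
  shows "T e (c \<odot>\<^bsub>M\<^esub> p) d \<in> N" "T f (c \<odot>\<^bsub>M\<^esub> p) d \<in> N"
  using N_elementary assms by (auto simp: elementary_in_def)

text \<open>
  The element \<open>T e p 0\<close> of \<open>E\<close> moves \<open>f\<close> to \<open>f + p\<close>, so \<open>N\<close> contains \<open>T (f + p) 0 c\<close>, and splitting off the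
  elementary factor leaves \<open>T p 0 c\<close>.
\<close>
lemma transvection_complement:
  assumes p: "p \<in> complement" and c: "c \<in> J"
  shows "T p \<zero>\<^bsub>M\<^esub> c \<in> N"
proof -
  note pD = complementD[OF p]
  let ?g = "T e p \<zero>"
  have "T e (\<one> \<odot>\<^bsub>M\<^esub> p) \<zero> \<in> E"
    using E_elementary p by (simp add: elementary_in_def)
  then have g: "?g \<in> E"
    using pD by simp
  have "T f (\<zero> \<odot>\<^bsub>M\<^esub> p) c \<in> N"
    using elementary_transvections(2)[OF p _ c] by simp
  then have "?g \<otimes>\<^bsub>A\<^esub> T f \<zero>\<^bsub>M\<^esub> c \<otimes>\<^bsub>A\<^esub> inv\<^bsub>A\<^esub> ?g \<in> N"
    using pD by (intro N_conj g) simp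
  moreover have "?g f = f \<oplus>\<^bsub>M\<^esub> p" "?g \<zero>\<^bsub>M\<^esub> = \<zero>\<^bsub>M\<^esub>"
    using pD by (simp_all add: transvection_apply)
  ultimately have "T (f \<oplus>\<^bsub>M\<^esub> p) \<zero>\<^bsub>M\<^esub> c \<in> N"
    using pD c transvection_conj[of ?g f "\<zero>\<^bsub>M\<^esub>" c] by (simp add: transvection_isometry)
  then have "T f (c \<odot>\<^bsub>M\<^esub> p) c \<otimes>\<^bsub>A\<^esub> T p \<zero>\<^bsub>M\<^esub> c \<in> N"
    using pD c transvection_split[of f p c] by simp
  then show ?thesis
    using pD p c elementary_transvections(2)[OF p c c]
    by - (rule Aut.subgroup_mem_factor(1)[OF N_subgroup, of "T f (c \<odot>\<^bsub>M\<^esub> p) c"]; simp add: transvection_aut)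
qed

text \<open>
  Since \<open>T u v 0 = T v u 0\<close>, this is a transvection along \<open>c p\<close>, which is additive in its second
  argument \<open>a e + b f\<close> up to a transvection along \<open>p\<close>.
\<close>
lemma transvection_plane_complement:
  assumes a: "a \<in> carrier R" and b: "b \<in> carrier R" and p: "p \<in> complement" and c: "c \<in> J"
  shows "T (a \<odot>\<^bsub>M\<^esub> e \<oplus>\<^bsub>M\<^esub> b \<odot>\<^bsub>M\<^esub> f) (c \<odot>\<^bsub>M\<^esub> p) \<zero> \<in> N"
proof -
  note pD = complementD[OF p]
  let ?q = "c \<odot>\<^bsub>M\<^esub> p"
  have cR: "c \<in> carrier R"
    using c by simp
  have ea: "T ?q (a \<odot>\<^bsub>M\<^esub> e) \<zero> \<in> N"
    using elementary_transvections(1)[OF p, of "a \<otimes> c" \<zero>] a c cR pD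
      transvection_commute[of ?q "a \<odot>\<^bsub>M\<^esub> e"] transvection_smult[of e ?q a \<zero>]
    by (simp add: smult_assoc1)
  have fb: "T ?q (b \<odot>\<^bsub>M\<^esub> f) \<zero> \<in> N"
    using elementary_transvections(2)[OF p, of "b \<otimes> c" \<zero>] b c cR pD
      transvection_commute[of ?q "b \<odot>\<^bsub>M\<^esub> f"] transvection_smult[of f ?q b \<zero>]
    by (simp add: smult_assoc1)
  have q: "T ?q \<zero>\<^bsub>M\<^esub> (\<ominus> (a \<otimes> b)) \<in> N"
    using transvection_complement[OF p, of "c \<otimes> c \<otimes> \<ominus> (a \<otimes> b)"] a b c cR pD
    by (simp add: transvection_smult)
  have "T ?q (b \<odot>\<^bsub>M\<^esub> f) \<zero> \<otimes>\<^bsub>A\<^esub> T ?q \<zero>\<^bsub>M\<^esub> (\<ominus> (a \<otimes> b)) = T ?q (b \<odot>\<^bsub>M\<^esub> f) (\<ominus> (a \<otimes> b))"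
    using a b cR pD by (simp add: transvection_mult)
  moreover have "T ?q (a \<odot>\<^bsub>M\<^esub> e) \<zero> \<otimes>\<^bsub>A\<^esub> T ?q (b \<odot>\<^bsub>M\<^esub> f) (\<ominus> (a \<otimes> b)) =
      T ?q (a \<odot>\<^bsub>M\<^esub> e \<oplus>\<^bsub>M\<^esub> b \<odot>\<^bsub>M\<^esub> f) \<zero>"
    using a b cR pD by (simp add: transvection_mult R.l_neg R.m_comm[of b a])
  ultimately have "T ?q (a \<odot>\<^bsub>M\<^esub> e \<oplus>\<^bsub>M\<^esub> b \<odot>\<^bsub>M\<^esub> f) \<zero> \<in> N"
    using ea fb q by (metis N_mult)
  then show ?thesis
    using a b cR pD by (simp add: transvection_commute[of ?q])
qed

text \<open>
  This is the commutator of \<open>T h q 0\<close>, which lies in \<open>E\<close>, with \<open>T h (c p) 0\<close>, which lies in \<open>N\<close>.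
\<close>
lemma transvection_plane_double:
  assumes a: "a \<in> carrier R" and b: "b \<in> carrier R" and p: "p \<in> complement" and q: "q \<in> complement"
    and c: "c \<in> J" and h: "h = a \<odot>\<^bsub>M\<^esub> e \<oplus>\<^bsub>M\<^esub> b \<odot>\<^bsub>M\<^esub> f"
  shows "T h \<zero>\<^bsub>M\<^esub> (c \<otimes> B q p \<oplus> c \<otimes> B q p) \<in> N"
proof -
  note pD = complementD[OF p] and qD = complementD[OF q]
  have cR: "c \<in> carrier R"
    using c by simp
  have hM: "h \<in> carrier M" and hp: "B h p = \<zero>" and hq: "B h q = \<zero>" and qh: "B q h = \<zero>"
    using a b pD qD by (simp_all add: h)
  let ?g = "T h q \<zero>" and ?d = "c \<otimes> B q p"
  \<comment> \<open>The absolute version of the previous lemma puts \<open>T h q 0\<close> into \<open>E\<close>.\<close>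
  interpret E: elementary_normal R M B e f E E "carrier R"
  proof
    show "g \<otimes>\<^bsub>A\<^esub> x \<otimes>\<^bsub>A\<^esub> inv\<^bsub>A\<^esub> g \<in> E" if "g \<in> E" "x \<in> E" for g x
      using that by (simp add: subgroup.m_closed[OF E_subgroup] subgroup.m_inv_closed[OF E_subgroup])
  qed (use R.oneideal E_subgroup E_elementary in \<open>auto simp: subgroup_def\<close>)
  have "T h (\<one> \<odot>\<^bsub>M\<^esub> q) \<zero> \<in> E"
    unfolding h using a b q by (intro E.transvection_plane_complement) simp_all
  then have g: "?g \<in> E"
    using qD by simp
  have t: "T h (c \<odot>\<^bsub>M\<^esub> p) \<zero> \<in> N"
    unfolding h using a b p c by (rule transvection_plane_complement)
  have "?g \<otimes>\<^bsub>A\<^esub> T h (c \<odot>\<^bsub>M\<^esub> p) \<zero> \<otimes>\<^bsub>A\<^esub> inv\<^bsub>A\<^esub> ?g \<in> N"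
    by (rule N_conj[OF g t])
  moreover have "?g h = h" "?g (c \<odot>\<^bsub>M\<^esub> p) = c \<odot>\<^bsub>M\<^esub> p \<oplus>\<^bsub>M\<^esub> ?d \<odot>\<^bsub>M\<^esub> h"
    using hM hp hq qh pD qD cR by (simp_all add: transvection_apply)
  ultimately have "T h (c \<odot>\<^bsub>M\<^esub> p \<oplus>\<^bsub>M\<^esub> ?d \<odot>\<^bsub>M\<^esub> h) \<zero> \<in> N"
    using hM hp hq pD qD cR transvection_conj[of ?g h "c \<odot>\<^bsub>M\<^esub> p" \<zero>] by (simp add: transvection_isometry)
  moreover have "T h (c \<odot>\<^bsub>M\<^esub> p) \<zero> \<otimes>\<^bsub>A\<^esub> T h (?d \<odot>\<^bsub>M\<^esub> h) \<zero> = T h (c \<odot>\<^bsub>M\<^esub> p \<oplus>\<^bsub>M\<^esub> ?d \<odot>\<^bsub>M\<^esub> h) \<zero>"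
    using hM hp pD qD cR form_skew[of h p] by (simp add: transvection_mult)
  ultimately have "T h (?d \<odot>\<^bsub>M\<^esub> h) \<zero> \<in> N"
    using hM hp pD qD cR t
    by - (rule Aut.subgroup_mem_factor(1)[OF N_subgroup, of "T h (c \<odot>\<^bsub>M\<^esub> p) \<zero>"]; simp add: transvection_aut)
  then show ?thesis
    using hM pD qD cR by (simp add: transvection_parallel)
qed

end

locale full_elementary_normal = elementary_normal +
  fixes half
  assumes half_closed: "half \<in> carrier R" and two_half: "(\<one> \<oplus> \<one>) \<otimes> half = \<one>"
    and form_ideal: "\<one> \<in> genideal R {B p q | p q. p \<in> complement \<and> q \<in> complement}"
begin

text \<open>
  The multipliers \<open>s\<close> for which all \<open>T h 0 (c s)\<close> with \<open>c \<in> J\<close> lie in \<open>N\<close> form an ideal. It contains the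
  values of the form on the complement by the commutator formula applied to \<open>c/2\<close>.
\<close>
lemma transvection_plane:
  assumes a: "a \<in> carrier R" and b: "b \<in> carrier R" and c: "c \<in> J"
    and h: "h = a \<odot>\<^bsub>M\<^esub> e \<oplus>\<^bsub>M\<^esub> b \<odot>\<^bsub>M\<^esub> f"
  shows "T h \<zero>\<^bsub>M\<^esub> c \<in> N"
proof -
  define K where "K = {s \<in> carrier R. \<forall>c\<in>J. T h \<zero>\<^bsub>M\<^esub> (c \<otimes> s) \<in> N}"
  have hM: "h \<in> carrier M"
    using a b by (simp add: h)
  have add: "s \<oplus> t \<in> K" if "s \<in> K" "t \<in> K" for s t
  proof -
    have "T h \<zero>\<^bsub>M\<^esub> (c \<otimes> (s \<oplus> t)) = T h \<zero>\<^bsub>M\<^esub> (c \<otimes> s) \<otimes>\<^bsub>A\<^esub> T h \<zero>\<^bsub>M\<^esub> (c \<otimes> t)" if "c \<in> J" for c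
      using that \<open>s \<in> K\<close> \<open>t \<in> K\<close> hM by (simp add: K_def transvection_mult R.r_distr)
    then show ?thesis
      using that by (simp add: K_def N_mult)
  qed
  have mult: "r \<otimes> s \<in> K" if "s \<in> K" "r \<in> carrier R" for r s
  proof -
    have "c \<otimes> (r \<otimes> s) = (c \<otimes> r) \<otimes> s" if "c \<in> J" for c
      using that \<open>s \<in> K\<close> \<open>r \<in> carrier R\<close> by (simp add: K_def R.m_assoc)
    then show ?thesis
      using that by (simp add: K_def)
  qed
  have zero: "\<zero> \<in> K"
    using hM subgroup.one_closed[OF N_subgroup] by (simp add: K_def transvection_id aut_one)
  have "ideal K R"
  proof (rule idealI)
    show "ring R" ..
    show "subgroup K (add_monoid R)"
    proof (rule R.add.subgroupI)
      show "K \<subseteq> carrier R" "K \<noteq> {}"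
        using zero by (auto simp: K_def)
      fix s assume s: "s \<in> K"
      then have "\<ominus> s = \<ominus> \<one> \<otimes> s"
        by (simp add: K_def R.l_minus)
      then show "\<ominus> s \<in> K"
        using mult[OF s, of "\<ominus> \<one>"] by simp
    qed (use add in auto)
    show "x \<otimes> s \<in> K" if "s \<in> K" "x \<in> carrier R" for s x
      using mult that by simp
    show "s \<otimes> x \<in> K" if "s \<in> K" "x \<in> carrier R" for s x
      using mult[OF that] that by (simp add: R.m_comm K_def)
  qed
  moreover have "B p q \<in> K" if "p \<in> complement" "q \<in> complement" for p q
  proof -
    have "c \<otimes> B p q = (c \<otimes> half) \<otimes> B p q \<oplus> (c \<otimes> half) \<otimes> B p q" if "c \<in> J" for c
    proof -
      have "c \<otimes> B p q = ((\<one> \<oplus> \<one>) \<otimes> half) \<otimes> (c \<otimes> B p q)"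
        using that \<open>p \<in> complement\<close> \<open>q \<in> complement\<close> by (simp add: two_half complementD)
      also have "\<dots> = (c \<otimes> half) \<otimes> B p q \<oplus> (c \<otimes> half) \<otimes> B p q"
        using that \<open>p \<in> complement\<close> \<open>q \<in> complement\<close> half_closed
        by (simp add: complementD R.l_distr R.r_distr R.m_ac)
      finally show ?thesis .
    qed
    moreover have "T h \<zero>\<^bsub>M\<^esub> ((c \<otimes> half) \<otimes> B p q \<oplus> (c \<otimes> half) \<otimes> B p q) \<in> N" if "c \<in> J" for c
      using transvection_plane_double[OF a b \<open>q \<in> complement\<close> \<open>p \<in> complement\<close> _ h] that half_closed by simp
    ultimately have "T h \<zero>\<^bsub>M\<^esub> (c \<otimes> B p q) \<in> N" if "c \<in> J" for c
      using that by metis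
    then show ?thesis
      using that by (simp add: K_def complementD)
  qed
  ultimately have "genideal R {B p q | p q. p \<in> complement \<and> q \<in> complement} \<subseteq> K"
    by (intro R.genideal_minimal) auto
  then have "\<one> \<in> K"
    using form_ideal by auto
  then show ?thesis
    using c by (auto simp: K_def)
qed

theorem rank_one_transvection:
  assumes x: "x \<in> carrier M" and c: "c \<in> J"
  shows "T x \<zero>\<^bsub>M\<^esub> c \<in> N"
proof -
  obtain a b p where a: "a \<in> carrier R" and b: "b \<in> carrier R" and p: "p \<in> complement"
    and x: "x = (a \<odot>\<^bsub>M\<^esub> e \<oplus>\<^bsub>M\<^esub> b \<odot>\<^bsub>M\<^esub> f) \<oplus>\<^bsub>M\<^esub> p"
    using hyperbolic_decomposition[OF x] .
  define h where "h = a \<odot>\<^bsub>M\<^esub> e \<oplus>\<^bsub>M\<^esub> b \<odot>\<^bsub>M\<^esub> f"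
  have hM: "h \<in> carrier M" and hp: "B h p = \<zero>" and pM: "p \<in> carrier M" and cR: "c \<in> carrier R"
    using a b c complementD[OF p] by (simp_all add: h_def)
  have "T h (c \<odot>\<^bsub>M\<^esub> p) \<zero> \<otimes>\<^bsub>A\<^esub> T h \<zero>\<^bsub>M\<^esub> c = T h (c \<odot>\<^bsub>M\<^esub> p) c"
    using hM hp pM cR by (simp add: transvection_mult)
  moreover have "T (h \<oplus>\<^bsub>M\<^esub> p) \<zero>\<^bsub>M\<^esub> c = T h (c \<odot>\<^bsub>M\<^esub> p) c \<otimes>\<^bsub>A\<^esub> T p \<zero>\<^bsub>M\<^esub> c"
    using hM hp pM cR by (rule_tac transvection_split)
  moreover have "T h (c \<odot>\<^bsub>M\<^esub> p) \<zero> \<in> N"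
    unfolding h_def using a b p c by (rule transvection_plane_complement)
  moreover have "T h \<zero>\<^bsub>M\<^esub> c \<in> N"
    using a b c h_def by (rule transvection_plane)
  moreover have "T p \<zero>\<^bsub>M\<^esub> c \<in> N"
    using p c by (rule transvection_complement)
  ultimately show ?thesis
    unfolding x h_def[symmetric] by (metis N_mult)
qed

lemma transvection_scaled:
  assumes "u \<in> carrier M" "w \<in> carrier M" "B u w = \<zero>" and c: "c \<in> J" and d: "d \<in> J"
  shows "T u (c \<odot>\<^bsub>M\<^esub> w) d \<in> N"
proof -
  have cR: "c \<in> carrier R" "d \<in> carrier R"
    using c d by simp_all
  have "T u (c \<odot>\<^bsub>M\<^esub> w) c \<otimes>\<^bsub>A\<^esub> T w \<zero>\<^bsub>M\<^esub> c \<in> N"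
    using transvection_split[of u w c] rank_one_transvection[of "u \<oplus>\<^bsub>M\<^esub> w" c] assms cR by simp
  then have "T u (c \<odot>\<^bsub>M\<^esub> w) c \<in> N"
    using assms cR rank_one_transvection[of w c]
    by - (rule Aut.subgroup_mem_factor(2)[OF N_subgroup, of _ "T w \<zero>\<^bsub>M\<^esub> c"]; simp add: transvection_aut)
  moreover have "T u \<zero>\<^bsub>M\<^esub> (\<ominus> c \<oplus> d) \<in> N"
    using rank_one_transvection[of u "\<ominus> c \<oplus> d"] assms by simp
  moreover have "T u (c \<odot>\<^bsub>M\<^esub> w) c \<otimes>\<^bsub>A\<^esub> T u \<zero>\<^bsub>M\<^esub> (\<ominus> c \<oplus> d) = T u (c \<odot>\<^bsub>M\<^esub> w) d"
    using assms cR by (simp add: transvection_mult R.r_neg2)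
  ultimately show ?thesis
    by (metis N_mult)
qed

text \<open>
  For \<open>v = c x\<close> the projection of \<open>v\<close> to the orthogonal complement of \<open>u\<close> is \<open>c\<close> times the projection of
  \<open>x\<close>, so polarization applies; sums are handled by the composition law, whose correction term lies in \<open>J\<close>.
\<close>
lemma transvection_projected:
  assumes u: "u \<in> carrier M" and y: "y \<in> carrier M" and uy: "B u y = \<one>"
    and v: "v \<in> ideal_smult M J" and d: "d \<in> J"
  shows "T u (v \<oplus>\<^bsub>M\<^esub> \<ominus> B u v \<odot>\<^bsub>M\<^esub> y) d \<in> N"
proof -
  define pr where "pr v = v \<oplus>\<^bsub>M\<^esub> \<ominus> B u v \<odot>\<^bsub>M\<^esub> y" for v
  have pr_closed: "pr w \<in> carrier M" and pr_perp: "B u (pr w) = \<zero>" if "w \<in> carrier M" for w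
    using that u y uy by (simp_all add: pr_def R.r_neg)
  have pr_scaled: "T u (pr (c \<odot>\<^bsub>M\<^esub> x)) d \<in> N" if "c \<in> J" "x \<in> carrier M" "d \<in> J" for c x d
  proof -
    have "pr (c \<odot>\<^bsub>M\<^esub> x) = c \<odot>\<^bsub>M\<^esub> pr x"
      using that u y by (simp add: pr_def smult_r_distr smult_assoc1[symmetric] R.r_minus)
    then show ?thesis
      using transvection_scaled[OF u pr_closed pr_perp] that by simp
  qed
  from J_ideal v have "\<forall>d\<in>J. T u (pr v) d \<in> N"
  proof (induction rule: ideal_smult_induct)
    case zero
    show ?case
      using pr_scaled[of \<zero> "\<zero>\<^bsub>M\<^esub>"] by simp
  next
    case (scaled c x)
    then show ?case
      using pr_scaled by simp
  next
    case (add h k)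
    note hk = add.hyps
    then have M: "h \<in> carrier M" "k \<in> carrier M"
      using ideal_smult_carrier[OF J_ideal] by simp_all
    have "B (pr h) (pr k) = B h (pr k) \<oplus> \<ominus> B u h \<otimes> B y (pr k)"
      using M u y pr_closed by (simp add: pr_def[of h])
    moreover have "B u h \<in> J"
      using form_ideal_smult[OF J_ideal hk(1) u] form_skew[of h u] M u by simp
    moreover have "B h (pr k) \<in> J"
      using form_ideal_smult[OF J_ideal hk(1) pr_closed[OF M(2)]] .
    ultimately have cross: "B (pr h) (pr k) \<in> J"
      using y pr_closed[OF M(2)] by simp
    have pr_add: "pr (h \<oplus>\<^bsub>M\<^esub> k) = pr h \<oplus>\<^bsub>M\<^esub> pr k"
      using M u y by (simp add: pr_def smult_l_distr R.minus_add M.a_ac)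
    have "T u (pr (h \<oplus>\<^bsub>M\<^esub> k)) d \<in> N" if d: "d \<in> J" for d
    proof -
      let ?d = "d \<oplus> \<ominus> B (pr h) (pr k)"
      have "T u (pr h) ?d \<otimes>\<^bsub>A\<^esub> T u (pr k) \<zero> = T u (pr h \<oplus>\<^bsub>M\<^esub> pr k) d"
        using u M pr_closed pr_perp d by (simp add: transvection_mult R.a_assoc R.l_neg)
      moreover have "T u (pr h) ?d \<in> N" "T u (pr k) \<zero> \<in> N"
        using add.IH cross d by simp_all
      ultimately show ?thesis
        unfolding pr_add by (metis N_mult)
    qed
    then show ?case by simp
  qed
  then show ?thesis
    using d by (simp add: pr_def)
qed

theorem transvection_in_normal:
  assumes u: "u \<in> carrier M" and v: "v \<in> ideal_smult M J" and uv: "B u v = \<zero>" and d: "d \<in> J"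
    and unimod: "(\<exists>y\<in>carrier M. B u y = \<one>) \<or> unimodular R M v"
  shows "T u v d \<in> N"
  using unimod
proof
  assume "\<exists>y\<in>carrier M. B u y = \<one>"
  then obtain y where "y \<in> carrier M" "B u y = \<one>" by auto
  from transvection_projected[OF u this v d] show ?thesis
    using uv ideal_smult_carrier[OF J_ideal v] \<open>y \<in> carrier M\<close> by simp
next
  assume "unimodular R M v"
  then obtain g where "g \<in> mod_hom R M (self_module R)" "g v = \<one>"
    by (auto simp: unimodular_def)
  with mod_hom_ideal_smult[OF J_ideal _ v] have "\<one> \<in> J"
    by metis
  from transvection_scaled[OF u ideal_smult_carrier[OF J_ideal v] uv this d] show ?thesis
    using ideal_smult_carrier[OF J_ideal v] by simp
qed

end

section \<open>The ideal generated by the values of the form\<close>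

text \<open>
  Linear combinations of \<open>x 0, \<dots>, x (k - 1)\<close> with coefficients in \<open>J\<close>, built one vector at a time so that
  vectors can be eliminated by induction.
\<close>
primrec combinations :: "('a, 'b, 'm) module_scheme \<Rightarrow> 'a set \<Rightarrow> (nat \<Rightarrow> 'b) \<Rightarrow> nat \<Rightarrow> 'b set" where
  "combinations M J x 0 = {\<zero>\<^bsub>M\<^esub>}"
| "combinations M J x (Suc k) =
     {y \<oplus>\<^bsub>M\<^esub> c \<odot>\<^bsub>M\<^esub> x k | y c. y \<in> combinations M J x k \<and> c \<in> J}"

context module
begin

lemma combinations_closed:
  assumes J: "ideal J R" and x: "\<And>i. x i \<in> carrier M"
  shows "y \<in> combinations M J x k \<Longrightarrow> y \<in> carrier M"
    and "y \<in> combinations M J x k \<Longrightarrow> z \<in> combinations M J x k \<Longrightarrow> y \<oplus>\<^bsub>M\<^esub> z \<in> combinations M J x k"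
    and "y \<in> combinations M J x k \<Longrightarrow> r \<in> carrier R \<Longrightarrow> r \<odot>\<^bsub>M\<^esub> y \<in> combinations M J x k"
proof -
  interpret J: ideal J R by (rule J)
  show closed: "y \<in> combinations M J x k \<Longrightarrow> y \<in> carrier M" for y k
    by (induction k arbitrary: y) (use x J.Icarr in auto)
  show "y \<in> combinations M J x k \<Longrightarrow> z \<in> combinations M J x k \<Longrightarrow> y \<oplus>\<^bsub>M\<^esub> z \<in> combinations M J x k"
  proof (induction k arbitrary: y z)
    case (Suc k)
    then obtain y' c z' d where yz: "y = y' \<oplus>\<^bsub>M\<^esub> c \<odot>\<^bsub>M\<^esub> x k" "z = z' \<oplus>\<^bsub>M\<^esub> d \<odot>\<^bsub>M\<^esub> x k"
      "y' \<in> combinations M J x k" "z' \<in> combinations M J x k" "c \<in> J" "d \<in> J"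
      by auto
    then have "y \<oplus>\<^bsub>M\<^esub> z = (y' \<oplus>\<^bsub>M\<^esub> z') \<oplus>\<^bsub>M\<^esub> (c \<oplus> d) \<odot>\<^bsub>M\<^esub> x k"
      using x J.Icarr closed by (simp add: smult_l_distr M.a_ac)
    then show ?case
      using Suc.IH yz J.a_closed by auto
  qed simp
  show "y \<in> combinations M J x k \<Longrightarrow> r \<in> carrier R \<Longrightarrow> r \<odot>\<^bsub>M\<^esub> y \<in> combinations M J x k"
  proof (induction k arbitrary: y)
    case (Suc k)
    then obtain y' c where y: "y = y' \<oplus>\<^bsub>M\<^esub> c \<odot>\<^bsub>M\<^esub> x k" "y' \<in> combinations M J x k" "c \<in> J"
      by auto
    then have "r \<odot>\<^bsub>M\<^esub> y = r \<odot>\<^bsub>M\<^esub> y' \<oplus>\<^bsub>M\<^esub> (r \<otimes> c) \<odot>\<^bsub>M\<^esub> x k"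
      using x J.Icarr closed Suc.prems by (simp add: smult_r_distr smult_assoc1)
    moreover have "r \<odot>\<^bsub>M\<^esub> y' \<in> combinations M J x k" "r \<otimes> c \<in> J"
      using Suc.IH Suc.prems y J.I_l_closed by auto
    ultimately show ?case
      by (simp only: combinations.simps mem_Collect_eq) blast
  qed simp
qed

text \<open>
  Elimination of one generator at a time: from \<open>s x\<^sub>k = y + c x\<^sub>k\<close> with \<open>c \<in> J\<close> one gets \<open>(s - c) x\<^sub>k = y\<close>, where
  \<open>s - c\<close> is still outside the prime ideal \<open>J\<close>, and multiplying by \<open>s - c\<close> removes \<open>x\<^sub>k\<close> from every combination.
\<close>
lemma nakayama:
  assumes J: "primeideal J R" and x: "\<And>i. x i \<in> carrier M"
    and s: "s \<in> carrier R - J" and spans: "\<And>p. p \<in> carrier M \<Longrightarrow> s \<odot>\<^bsub>M\<^esub> p \<in> combinations M J x k"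
  shows "\<exists>s\<in>carrier R - J. \<forall>p\<in>carrier M. s \<odot>\<^bsub>M\<^esub> p = \<zero>\<^bsub>M\<^esub>"
  using s spans
proof (induction k arbitrary: s)
  case 0
  then show ?case by auto
next
  case (Suc k)
  interpret J: primeideal J R by (rule J)
  note closed = combinations_closed[OF J.ideal_axioms x]
  obtain y c where y: "y \<in> combinations M J x k" and c: "c \<in> J"
    and sx: "s \<odot>\<^bsub>M\<^esub> x k = y \<oplus>\<^bsub>M\<^esub> c \<odot>\<^bsub>M\<^esub> x k"
    using Suc.prems(2)[OF x[of k]] by auto
  have sR: "s \<in> carrier R" and cR: "c \<in> carrier R" and yM: "y \<in> carrier M"
    using Suc.prems(1) c J.Icarr closed(1)[OF y] by auto
  let ?t = "s \<ominus> c"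
  have tx: "?t \<odot>\<^bsub>M\<^esub> x k = y"
    using sx sR cR yM x by (simp add: R.minus_eq smult_l_distr smult_l_minus M.a_assoc M.r_neg)
  have "s = ?t \<oplus> c"
    using sR cR by (simp add: R.minus_eq R.a_assoc R.l_neg)
  then have "?t \<notin> J"
    using Suc.prems(1) c J.a_closed by fastforce
  then have "?t \<otimes> s \<in> carrier R - J"
    using Suc.prems(1) sR cR J.I_prime[of ?t s] by auto
  moreover have "(?t \<otimes> s) \<odot>\<^bsub>M\<^esub> p \<in> combinations M J x k" if p: "p \<in> carrier M" for p
  proof -
    obtain y' c' where y': "y' \<in> combinations M J x k" and c': "c' \<in> J"
      and sp: "s \<odot>\<^bsub>M\<^esub> p = y' \<oplus>\<^bsub>M\<^esub> c' \<odot>\<^bsub>M\<^esub> x k"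
      using Suc.prems(2)[OF p] by auto
    have "(?t \<otimes> s) \<odot>\<^bsub>M\<^esub> p = ?t \<odot>\<^bsub>M\<^esub> y' \<oplus>\<^bsub>M\<^esub> ?t \<odot>\<^bsub>M\<^esub> (c' \<odot>\<^bsub>M\<^esub> x k)"
      using p sR cR closed(1)[OF y'] x J.Icarr[OF c'] by (simp add: smult_assoc1 sp smult_r_distr)
    also have "?t \<odot>\<^bsub>M\<^esub> (c' \<odot>\<^bsub>M\<^esub> x k) = c' \<odot>\<^bsub>M\<^esub> (?t \<odot>\<^bsub>M\<^esub> x k)"
      using sR cR x J.Icarr[OF c'] by (simp add: smult_assoc1[symmetric] R.m_comm)
    finally show ?thesis
      using sR cR y y' J.Icarr[OF c'] by (simp add: tx closed)
  qed
  ultimately show ?case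
    using Suc.IH by blast
qed

text \<open>
  The dual basis of a projective module: an isomorphism of \<open>M \<oplus> N\<close> with \<open>R\<^sup>k\<close> writes each \<open>p\<close> as a combination
  of \<open>k\<close> fixed vectors whose coefficients are linear functionals of \<open>p\<close>,
  hence lie in \<open>J\<close>.
\<close>
lemma projective_spanned:
  assumes proj: "fg_projective R M" and J: "ideal J R"
    and functionals: "\<forall>g\<in>mod_hom R M (self_module R). \<forall>p\<in>carrier M. g p \<in> J"
  shows "\<exists>k x. (\<forall>i. x i \<in> carrier M) \<and> carrier M \<subseteq> combinations M J x k"
proof -
  obtain k and N :: "('a, nat \<Rightarrow> 'a) module" and F
    where N: "module R N" and F: "F \<in> mod_iso R (direct_sum M N) (free_module R k)"
    using proj by (auto simp: fg_projective_def)
  interpret N: module R N by (rule N)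
  let ?F = "free_module R k"
  have bij: "bij_betw F (carrier M \<times> carrier N) (carrier ?F)"
    and F_add: "\<And>p q p' q'. \<lbrakk>p \<in> carrier M; q \<in> carrier N; p' \<in> carrier M; q' \<in> carrier N\<rbrakk> \<Longrightarrow>
        F (p \<oplus>\<^bsub>M\<^esub> p', q \<oplus>\<^bsub>N\<^esub> q') = F (p, q) \<oplus>\<^bsub>?F\<^esub> F (p', q')"
    and F_smult: "\<And>a p q. \<lbrakk>a \<in> carrier R; p \<in> carrier M; q \<in> carrier N\<rbrakk> \<Longrightarrow>
        F (a \<odot>\<^bsub>M\<^esub> p, a \<odot>\<^bsub>N\<^esub> q) = a \<odot>\<^bsub>?F\<^esub> F (p, q)"
    using F by (auto simp: mod_iso_def mod_hom_def direct_sum_def)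
  define G where "G = inv_into (carrier M \<times> carrier N) F"
  have G_closed: "G z \<in> carrier M \<times> carrier N" and FG: "F (G z) = z" if "z \<in> carrier ?F" for z
    using that bij unfolding G_def
    by (metis bij_betw_imp_surj_on inv_into_into, metis bij_betw_inv_into_right)
  have GF: "G (F w) = w" if "w \<in> carrier M \<times> carrier N" for w
    using that bij unfolding G_def by (metis bij_betw_inv_into_left)
  define g where "g z = fst (G z)" for z
  have g_closed: "g z \<in> carrier M" if "z \<in> carrier ?F" for z
    using G_closed[OF that] by (auto simp: g_def)
  have g_add: "g (y \<oplus>\<^bsub>?F\<^esub> z) = g y \<oplus>\<^bsub>M\<^esub> g z" if yz: "y \<in> carrier ?F" "z \<in> carrier ?F" for y z
  proof -
    obtain p q p' q' where G: "G y = (p, q)" "G z = (p', q')"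
      by (metis surj_pair)
    then have c: "p \<in> carrier M" "q \<in> carrier N" "p' \<in> carrier M" "q' \<in> carrier N"
      using G_closed[OF yz(1)] G_closed[OF yz(2)] by auto
    have "y \<oplus>\<^bsub>?F\<^esub> z = F (p \<oplus>\<^bsub>M\<^esub> p', q \<oplus>\<^bsub>N\<^esub> q')"
      using F_add[OF c] FG[OF yz(1)] FG[OF yz(2)] G by simp
    then show ?thesis
      using GF[of "(p \<oplus>\<^bsub>M\<^esub> p', q \<oplus>\<^bsub>N\<^esub> q')"] c G by (simp add: g_def)
  qed
  have g_smult: "g (a \<odot>\<^bsub>?F\<^esub> z) = a \<odot>\<^bsub>M\<^esub> g z" if a: "a \<in> carrier R" and z: "z \<in> carrier ?F" for a z
  proof -
    obtain p q where G: "G z = (p, q)"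
      by (metis surj_pair)
    then have c: "p \<in> carrier M" "q \<in> carrier N"
      using G_closed[OF z] by auto
    have "a \<odot>\<^bsub>?F\<^esub> z = F (a \<odot>\<^bsub>M\<^esub> p, a \<odot>\<^bsub>N\<^esub> q)"
      using F_smult[OF a c] FG[OF z] G by simp
    then show ?thesis
      using GF[of "(a \<odot>\<^bsub>M\<^esub> p, a \<odot>\<^bsub>N\<^esub> q)"] a c G by (simp add: g_def)
  qed
  \<comment> \<open>Coordinates of \<open>R\<^sup>k\<close> are numbered from 1 but the vectors of \<open>combinations\<close> from 0, hence the shift.\<close>
  define unit where "unit j = (\<lambda>i\<in>{1..k}. if i = Suc j then \<one> else \<zero>)" for j
  have unit: "unit j \<in> carrier ?F" for j
    by (auto simp: unit_def free_module_def)
  define trunc where "trunc z j = (\<lambda>i\<in>{1..k}. if i \<le> j then z i else \<zero>)" for z j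
  have trunc: "trunc z j \<in> carrier ?F" if "z \<in> carrier ?F" for z j
    using that by (auto simp: trunc_def free_module_def PiE_iff)
  have spanned: "g (trunc z j) \<in> combinations M J (\<lambda>i. g (unit i)) j"
    if z: "z \<in> carrier ?F" and zJ: "\<And>i. i \<in> {1..k} \<Longrightarrow> z i \<in> J" and "j \<le> k" for z j
    using \<open>j \<le> k\<close>
  proof (induction j)
    case 0
    have "trunc z 0 = \<zero> \<odot>\<^bsub>?F\<^esub> unit 0"
      using unit[of 0] by (auto simp: trunc_def unit_def free_module_def fun_eq_iff)
    then show ?case
      using g_smult[OF R.zero_closed unit] g_closed[OF unit] by simp
  next
    case (Suc j)
    have zR: "z i \<in> carrier R" if "i \<in> {1..k}" for i
      using z that by (auto simp: free_module_def)
    have zSj: "z (Suc j) \<in> carrier R"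
      using zR[of "Suc j"] Suc.prems by simp
    have "trunc z (Suc j) = trunc z j \<oplus>\<^bsub>?F\<^esub> (z (Suc j) \<odot>\<^bsub>?F\<^esub> unit j)"
      using zSj zR Suc.prems by (auto simp: trunc_def unit_def free_module_def fun_eq_iff le_Suc_eq)
    moreover have "z (Suc j) \<odot>\<^bsub>?F\<^esub> unit j \<in> carrier ?F"
      using zR Suc.prems by (auto simp: free_module_def unit_def)
    ultimately have "g (trunc z (Suc j)) = g (trunc z j) \<oplus>\<^bsub>M\<^esub> z (Suc j) \<odot>\<^bsub>M\<^esub> g (unit j)"
      using g_add[OF trunc[OF z, of j], of "z (Suc j) \<odot>\<^bsub>?F\<^esub> unit j"]
        g_smult[OF zR[of "Suc j"] unit] Suc.prems by simp
    then show ?case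
      using Suc zJ[of "Suc j"] by auto
  qed
  have F_closed: "F w \<in> carrier ?F" if "w \<in> carrier M \<times> carrier N" for w
    using that bij by (auto simp: bij_betw_def)
  show ?thesis
  proof (intro exI conjI allI)
    show "g (unit i) \<in> carrier M" for i
      by (rule g_closed[OF unit])
    show "carrier M \<subseteq> combinations M J (\<lambda>i. g (unit i)) k"
    proof
      fix p assume p: "p \<in> carrier M"
      let ?z = "F (p, \<zero>\<^bsub>N\<^esub>)"
      have z: "?z \<in> carrier ?F"
        using F_closed p by simp
      have "?z i \<in> J" if i: "i \<in> {1..k}" for i
      proof -
        have "F (y, \<zero>\<^bsub>N\<^esub>) i \<in> carrier R" if "y \<in> carrier M" for y
          using F_closed[of "(y, \<zero>\<^bsub>N\<^esub>)"] i that by (auto simp: free_module_def)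
        moreover have "F (y \<oplus>\<^bsub>M\<^esub> y', \<zero>\<^bsub>N\<^esub>) i = F (y, \<zero>\<^bsub>N\<^esub>) i \<oplus> F (y', \<zero>\<^bsub>N\<^esub>) i"
          if "y \<in> carrier M" "y' \<in> carrier M" for y y'
          using F_add[OF that(1) _ that(2), of "\<zero>\<^bsub>N\<^esub>" "\<zero>\<^bsub>N\<^esub>"] i by (simp add: free_module_def)
        moreover have "F (a \<odot>\<^bsub>M\<^esub> y, \<zero>\<^bsub>N\<^esub>) i = a \<otimes> F (y, \<zero>\<^bsub>N\<^esub>) i"
          if "a \<in> carrier R" "y \<in> carrier M" for a y
          using F_smult[OF that, of "\<zero>\<^bsub>N\<^esub>"] i that by (simp add: free_module_def)
        ultimately have "(\<lambda>y. F (y, \<zero>\<^bsub>N\<^esub>) i) \<in> mod_hom R M (self_module R)"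
          by (auto simp: mod_hom_def self_module_def)
        from bspec[OF bspec[OF functionals this] p] show ?thesis .
      qed
      from spanned[OF z this, of k] have "g (trunc ?z k) \<in> combinations M J (\<lambda>i. g (unit i)) k"
        by simp
      moreover have "trunc ?z k = ?z"
        using z by (auto simp: trunc_def free_module_def PiE_iff extensional_def fun_eq_iff)
      ultimately show "p \<in> combinations M J (\<lambda>i. g (unit i)) k"
        using GF[of "(p, \<zero>\<^bsub>N\<^esub>)"] p by (simp add: g_def)
    qed
  qed
qed

text \<open>
  A localization whose denominators include an annihilator of the module is a single point, so the constant
  coefficient families 0 and 1 represent the same vector, although they differ in the local ring.
\<close>
lemma no_basis_of_annihilated_localization:
  assumes S: "S \<subseteq> carrier R" "\<one> \<in> S" "\<zero> \<notin> S" "\<And>s t. s \<in> S \<Longrightarrow> t \<in> S \<Longrightarrow> s \<otimes> t \<in> S"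
    and w: "w \<in> S" "\<And>x. x \<in> carrier M \<Longrightarrow> w \<odot>\<^bsub>M\<^esub> x = \<zero>\<^bsub>M\<^esub>" and d: "d \<ge> 1"
  shows "\<not> mod_basis (loc_ring R S) (loc_module R M S) d e"
proof
  assume basis: "mod_basis (loc_ring R S) (loc_module R M S) d e"
  let ?L = "loc_module R M S" and ?K = "loc_ring R S"
  define pt where "pt = carrier M \<times> S"
  have "w \<odot>\<^bsub>M\<^esub> (t \<odot>\<^bsub>M\<^esub> x) = \<zero>\<^bsub>M\<^esub>" if "t \<in> S" "x \<in> carrier M" for t x
    using that S(1) by (intro w(2)) auto
  then have rel: "loc_rel M S = pt \<times> pt"
    using w(1) by (auto simp: loc_rel_def pt_def intro!: bexI[of _ w])
  have pt0: "(\<zero>\<^bsub>M\<^esub>, \<one>) \<in> pt"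
    using S by (simp add: pt_def)
  have frac: "loc_frac M S x s = pt" if "x \<in> carrier M" "s \<in> S" for x s
    using that by (auto simp: loc_frac_def rel pt_def)
  have L_carrier: "carrier ?L = {pt}"
    using pt0 by (auto simp: loc_module_def quotient_def rel pt_def[symmetric])
  have L_zero: "\<zero>\<^bsub>?L\<^esub> = pt"
    using S by (simp add: loc_module_def frac)
  have L_add: "pt \<oplus>\<^bsub>?L\<^esub> pt = pt"
  proof -
    have "pt \<oplus>\<^bsub>?L\<^esub> pt = (\<Union>(x, s)\<in>pt. \<Union>(y, t)\<in>pt. pt)"
      using S by (auto simp: loc_module_def pt_def[symmetric] intro!: SUP_cong)
         (auto simp: pt_def subset_iff frac)
    then show ?thesis
      using pt0 by auto
  qed
  have K_carrier: "carrier ?K = (carrier R \<times> S) // loc_rel (self_module R) S"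
    by (simp add: loc_ring_def loc_module_def Let_def self_module_def)
  have refl: "(x, s) \<in> loc_frac (self_module R) S x s" if "x \<in> carrier R" "s \<in> S" for x s
    using that S by (auto simp: loc_frac_def loc_rel_def self_module_def)
  have L_smult: "U \<odot>\<^bsub>?L\<^esub> pt = pt" if U_K: "U \<in> carrier ?K" for U
  proof -
    obtain a r where U: "U = loc_frac (self_module R) S a r" and "a \<in> carrier R" "r \<in> S"
      using U_K unfolding K_carrier loc_frac_def by (auto elim!: quotientE)
    then have "(a, r) \<in> U" and "U \<subseteq> carrier R \<times> S"
      using refl by (auto simp: loc_frac_def loc_rel_def self_module_def)
    have "U \<odot>\<^bsub>?L\<^esub> pt = (\<Union>(a, r)\<in>U. \<Union>(x, s)\<in>pt. loc_frac M S (a \<odot>\<^bsub>M\<^esub> x) (r \<otimes> s))"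
      by (simp add: loc_module_def)
    also have "\<dots> = (\<Union>(a, r)\<in>U. \<Union>(x, s)\<in>pt. pt)"
    proof -
      have "loc_frac M S (a \<odot>\<^bsub>M\<^esub> x) (r \<otimes> s) = pt" if "(a, r) \<in> U" "(x, s) \<in> pt" for a r x s
        using that \<open>U \<subseteq> carrier R \<times> S\<close> S by (intro frac) (auto simp: pt_def)
      then show ?thesis
        by (intro SUP_cong) (auto intro!: SUP_cong)
    qed
    finally have "U \<odot>\<^bsub>?L\<^esub> pt = (\<Union>(a, r)\<in>U. \<Union>(x, s)\<in>pt. pt)" .
    then show ?thesis
      using \<open>(a, r) \<in> U\<close> pt0 by auto
  qed
  interpret L: comm_monoid "add_monoid ?L"
    by (rule comm_monoidI) (auto simp: L_carrier L_zero L_add)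
  have sum: "(\<Oplus>\<^bsub>?L\<^esub>i\<in>{1..d}. c i \<odot>\<^bsub>?L\<^esub> e i) = pt" if "c \<in> {1..d} \<rightarrow>\<^sub>E carrier ?K" for c
  proof -
    have "e i = pt" if "i \<in> {1..d}" for i
      using basis that by (auto simp: mod_basis_def L_carrier)
    then have "finprod (add_monoid ?L) (\<lambda>i. c i \<odot>\<^bsub>?L\<^esub> e i) {1..d} \<in> carrier (add_monoid ?L)"
      using that by (intro L.finprod_closed) (auto simp: L_carrier L_smult PiE_iff)
    then show ?thesis
      by (simp add: finsum_def L_carrier)
  qed
  define c where "c r = (\<lambda>i\<in>{1..d}. loc_frac (self_module R) S r \<one>)" for r
  have c: "c r \<in> {1..d} \<rightarrow>\<^sub>E carrier ?K" if "r \<in> carrier R" for r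
    using that S by (auto simp: c_def K_carrier loc_frac_def intro!: quotientI)
  have "c \<zero> = c \<one>"
    using basis sum[OF c[OF R.zero_closed]] sum[OF c[OF R.one_closed]] c
    by (auto simp: mod_basis_def L_carrier)
  from fun_cong[OF this, of 1] have "loc_frac (self_module R) S \<zero> \<one> = loc_frac (self_module R) S \<one> \<one>"
    using d by (simp add: c_def)
  then have "(\<one>, \<one>) \<in> loc_frac (self_module R) S \<zero> \<one>"
    using refl[of \<one> \<one>] S by simp
  then obtain v where "v \<in> S" "v \<otimes> (\<one> \<otimes> \<zero>) = v \<otimes> (\<one> \<otimes> \<one>)"
    by (auto simp: loc_frac_def loc_rel_def self_module_def)
  then show False
    using S by auto
qed

end

lemma (in cring) proper_ideal_in_maximal:
  assumes T: "ideal T R" and "\<one> \<notin> T"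
  obtains \<mm> where "maximalideal \<mm> R" "T \<subseteq> \<mm>"
proof -
  let ?S = "{K. ideal K R \<and> T \<subseteq> K \<and> \<one> \<notin> K}"
  have "\<exists>M\<in>?S. \<forall>K\<in>?S. M \<subseteq> K \<longrightarrow> K = M"
  proof (rule subset_Zorn_nonempty)
    show "?S \<noteq> {}"
      using assms by auto
    fix C assume C: "C \<noteq> {}" "subset.chain ?S C"
    then have "subset.chain {K. ideal K R} C"
      by (auto simp: pred_on.chain_def)
    from chain_Union_is_ideal[OF this] C(1) have "ideal (\<Union>C) R"
      by simp
    then show "\<Union>C \<in> ?S"
      using C by (auto simp: pred_on.chain_def)
  qed
  then obtain \<mm> where \<mm>: "ideal \<mm> R" "T \<subseteq> \<mm>" "\<one> \<notin> \<mm>"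
    and max: "\<And>K. ideal K R \<Longrightarrow> T \<subseteq> K \<Longrightarrow> \<one> \<notin> K \<Longrightarrow> \<mm> \<subseteq> K \<Longrightarrow> K = \<mm>"
    by auto
  have "maximalideal \<mm> R"
  proof (rule maximalidealI)
    show "carrier R \<noteq> \<mm>"
      using \<mm>(3) by auto
    show "K = \<mm> \<or> K = carrier R" if "ideal K R" "\<mm> \<subseteq> K" for K
      using max[OF that(1)] \<mm>(2) that ideal.one_imp_carrier[OF that(1)] by auto
  qed (rule \<mm>(1))
  then show thesis
    using \<mm>(2) that by auto
qed

lemma (in module) nondegenerate_representation:
  assumes "nondegenerate R M B" and g: "g \<in> mod_hom R M (self_module R)"
  obtains z where "z \<in> carrier M" "\<And>x. x \<in> carrier M \<Longrightarrow> B z x = g x"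
proof -
  have "restrict g (carrier M) \<in> carrier (dual_module R M)"
    using g by (auto simp: dual_module_def mod_hom_def)
  moreover have "(\<lambda>z. \<lambda>x\<in>carrier M. B z x) ` carrier M = carrier (dual_module R M)"
    using assms(1) by (auto simp: nondegenerate_def mod_iso_def bij_betw_def)
  ultimately obtain z where z: "z \<in> carrier M" "(\<lambda>x\<in>carrier M. B z x) = restrict g (carrier M)"
    by (metis (no_types, lifting) imageE)
  then show thesis
    using that[of z] by (metis restrict_apply')
qed

text \<open>
  Otherwise some maximal ideal contains all values of the form. By nondegeneracy it contains all values of
  linear functionals, so Nakayama's lemma yields an annihilator of \<open>P\<close> outside that ideal, and the
  localization there cannot have positive rank.
\<close>
lemma form_ideal_of_positive_rank:
  assumes "cring R" and symplectic: "symplectic_module R P B"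
    and rank: "has_rank R P d" "d \<ge> 1"
  shows "\<one>\<^bsub>R\<^esub> \<in> genideal R {B p q | p q. p \<in> carrier P \<and> q \<in> carrier P}" (is "_ \<in> ?T")
proof (rule ccontr)
  assume no_unit: "\<one>\<^bsub>R\<^esub> \<notin> ?T"
  have proj: "fg_projective R P" and nondeg: "nondegenerate R P B"
    and alt: "alternating_bilinear R P B"
    using symplectic by (auto simp: symplectic_module_def)
  interpret module R P
    using proj by (simp add: fg_projective_def)
  have form_values: "{B p q | p q. p \<in> carrier P \<and> q \<in> carrier P} \<subseteq> carrier R"
    using alt by (auto simp: alternating_bilinear_def mod_hom_def self_module_def)
  obtain \<mm> where \<mm>: "maximalideal \<mm> R" "?T \<subseteq> \<mm>"
    using R.proper_ideal_in_maximal[OF R.genideal_ideal[OF form_values] no_unit] .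
  interpret \<mm>: primeideal \<mm> R
    by (rule R.maximalideal_prime[OF \<mm>(1)])
  have one: "\<one>\<^bsub>R\<^esub> \<notin> \<mm>"
    using \<mm>.I_notcarr \<mm>.one_imp_carrier by auto
  have "g p \<in> \<mm>" if g: "g \<in> mod_hom R P (self_module R)" and p: "p \<in> carrier P" for g p
  proof -
    obtain z where z: "z \<in> carrier P" "\<And>x. x \<in> carrier P \<Longrightarrow> B z x = g x"
      using nondegenerate_representation[OF nondeg g] by blast
    then have "g p \<in> {B p q | p q. p \<in> carrier P \<and> q \<in> carrier P}"
      using z(1) z(2)[OF p, symmetric] p by blast
    then show ?thesis
      using R.genideal_self[OF form_values] \<mm>(2) by blast
  qed
  with projective_spanned[OF proj \<mm>.ideal_axioms]
  obtain k x where x: "\<And>i. x i \<in> carrier P" "carrier P \<subseteq> combinations P \<mm> x k"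
    by auto
  have "\<one>\<^bsub>R\<^esub> \<odot>\<^bsub>P\<^esub> p \<in> combinations P \<mm> x k" if "p \<in> carrier P" for p
    using x(2) that by auto
  with nakayama[OF \<mm>.primeideal_axioms, where x = x and s = "\<one>\<^bsub>R\<^esub>" and k = k] x(1) one
  obtain s where s: "s \<in> carrier R - \<mm>" "\<And>p. p \<in> carrier P \<Longrightarrow> s \<odot>\<^bsub>P\<^esub> p = \<zero>\<^bsub>P\<^esub>"
    by auto
  have "\<not> mod_basis (ring_at R \<mm>) (module_at R P \<mm>) d e" for e
    using one \<mm>.I_prime s rank(2) \<mm>.zero_closed by (intro no_basis_of_annihilated_localization[of _ s]) auto
  then show False
    using rank(1) \<mm>.primeideal_axioms by (auto simp: has_rank_def)
qed

section \<open>The sum of a hyperbolic plane and a symplectic module\<close>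

lemma module_self_module: "cring R \<Longrightarrow> module R (self_module R)"
proof -
  assume "cring R"
  then interpret cring R .
  show ?thesis
  proof (rule moduleI)
    show "abelian_group (self_module R)"
      by (rule abelian_groupI) (auto simp: self_module_def a_ac intro: bexI[of _ "\<ominus>\<^bsub>R\<^esub> _"] l_neg)
  qed (auto simp: self_module_def l_distr r_distr m_ac is_cring)
qed

lemma module_direct_sum:
  assumes "module R M" "module R N"
  shows "module R (direct_sum M N)"
proof -
  interpret M: module R M by fact
  interpret N: module R N by fact
  show ?thesis
  proof (rule moduleI)
    show "abelian_group (direct_sum M N)"
    proof (rule abelian_groupI)
      fix x assume "x \<in> carrier (direct_sum M N)"
      then show "\<exists>y\<in>carrier (direct_sum M N). y \<oplus>\<^bsub>direct_sum M N\<^esub> x = \<zero>\<^bsub>direct_sum M N\<^esub>"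
        by (intro bexI[of _ "(\<ominus>\<^bsub>M\<^esub> fst x, \<ominus>\<^bsub>N\<^esub> snd x)"])
          (auto simp: direct_sum_def M.M.l_neg N.M.l_neg)
    qed (auto simp: direct_sum_def M.M.a_ac N.M.a_ac)
  qed (auto simp: direct_sum_def M.is_cring M.smult_l_distr N.smult_l_distr
      M.smult_r_distr N.smult_r_distr M.smult_assoc1 N.smult_assoc1)
qed

lemma hyp_module_simps:
  "carrier (hyp_module R P) = carrier R \<times> carrier R \<times> carrier P"
  "\<zero>\<^bsub>hyp_module R P\<^esub> = (\<zero>\<^bsub>R\<^esub>, \<zero>\<^bsub>R\<^esub>, \<zero>\<^bsub>P\<^esub>)"
  "(a, b, p) \<oplus>\<^bsub>hyp_module R P\<^esub> (a', b', p') = (a \<oplus>\<^bsub>R\<^esub> a', b \<oplus>\<^bsub>R\<^esub> b', p \<oplus>\<^bsub>P\<^esub> p')"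
  "c \<odot>\<^bsub>hyp_module R P\<^esub> (a, b, p) = (c \<otimes>\<^bsub>R\<^esub> a, c \<otimes>\<^bsub>R\<^esub> b, c \<odot>\<^bsub>P\<^esub> p)"
  by (simp_all add: hyp_module_def direct_sum_def self_module_def)

lemma self_module_simps:
  "carrier (self_module R) = carrier R" "x \<oplus>\<^bsub>self_module R\<^esub> y = x \<oplus>\<^bsub>R\<^esub> y"
  "a \<odot>\<^bsub>self_module R\<^esub> x = a \<otimes>\<^bsub>R\<^esub> x"
  by (simp_all add: self_module_def)

locale symplectic_sum = P: alternating_module R P B for R (structure) and P (structure) and B +
  assumes nondegenerate: "nondegenerate R P B"
begin

abbreviation "Q \<equiv> hyp_module R P"
abbreviation "BQ \<equiv> hyp_form R B"

lemma alternating_module_Q: "alternating_module R Q BQ"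
proof -
  have "module R Q"
    unfolding hyp_module_def
    by (intro module_direct_sum module_self_module P.is_cring P.module_axioms)
  moreover have "alternating_bilinear R Q BQ"
    by (auto simp: alternating_bilinear_def mod_hom_def self_module_simps hyp_module_simps hyp_form_def
        P.R.minus_eq P.R.l_distr P.R.r_distr P.R.l_minus P.R.r_minus P.R.minus_add P.R.m_ac P.R.a_ac P.R.r_neg)
  ultimately show ?thesis
    by (simp add: alternating_module_def alternating_module_axioms_def)
qed

sublocale Q: hyperbolic_pair R Q BQ "(\<one>, \<zero>, \<zero>\<^bsub>P\<^esub>)" "(\<zero>, \<one>, \<zero>\<^bsub>P\<^esub>)"
proof -
  interpret alternating_module R Q BQ
    by (rule alternating_module_Q)
  show "hyperbolic_pair R Q BQ (\<one>, \<zero>, \<zero>\<^bsub>P\<^esub>) (\<zero>, \<one>, \<zero>\<^bsub>P\<^esub>)"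
    by unfold_locales (simp_all add: hyp_module_simps hyp_form_def P.R.minus_eq)
qed

lemma complement_eq: "Q.complement = {(\<zero>, \<zero>, p) | p. p \<in> carrier P}"
  unfolding Q.complement_def by (auto simp: hyp_module_simps hyp_form_def P.R.minus_eq)

lemma form_complement: "p \<in> carrier P \<Longrightarrow> q \<in> carrier P \<Longrightarrow> BQ (\<zero>, \<zero>, p) (\<zero>, \<zero>, q) = B p q"
  by (simp add: hyp_form_def P.R.minus_eq)

lemma elem_rho_eq:
  "q \<in> carrier P \<Longrightarrow> \<alpha> \<in> carrier R \<Longrightarrow>
    elem_rho R P B q \<alpha> = Q.T (\<zero>, \<one>, \<zero>\<^bsub>P\<^esub>) (\<zero>, \<zero>, q) \<alpha>"
  using P.form_skew[of _ q]
  by (auto simp: elem_rho_def sp_transvection_def fun_eq_iff hyp_module_simps hyp_form_def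
      P.R.minus_eq P.M.minus_eq P.smult_l_minus P.R.l_minus P.R.r_minus)

lemma elem_mu_eq:
  "q \<in> carrier P \<Longrightarrow> \<beta> \<in> carrier R \<Longrightarrow>
    elem_mu R P B q \<beta> = Q.T (\<one>, \<zero>, \<zero>\<^bsub>P\<^esub>) (\<zero>, \<zero>, \<ominus>\<^bsub>P\<^esub> q) \<beta>"
  using P.form_skew[of q]
  by (auto simp: elem_mu_def sp_transvection_def fun_eq_iff hyp_module_simps hyp_form_def
      P.R.minus_eq P.M.minus_eq P.smult_r_minus P.R.l_minus P.R.r_minus)

text \<open>
  The form on \<open>Q\<close> represents every functional \<open>g\<close>: pairing with \<open>(g f, - g e, z)\<close> does, where \<open>z\<close> represents
  the restriction of \<open>g\<close> to \<open>P\<close>.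
\<close>
lemma unimodular_pairing:
  assumes "unimodular R Q u" and u: "u \<in> carrier Q"
  shows "\<exists>y\<in>carrier Q. BQ u y = \<one>"
proof -
  obtain g where g: "g \<in> mod_hom R Q (self_module R)" and gu: "g u = \<one>"
    using assms by (auto simp: unimodular_def)
  have g_add: "g (x \<oplus>\<^bsub>Q\<^esub> y) = g x \<oplus> g y" if "x \<in> carrier Q" "y \<in> carrier Q" for x y
    using g that by (simp add: mod_hom_def self_module_simps)
  have g_smult: "g (a \<odot>\<^bsub>Q\<^esub> x) = a \<otimes> g x" if "a \<in> carrier R" "x \<in> carrier Q" for a x
    using g that by (simp add: mod_hom_def self_module_simps)
  have g_R: "g x \<in> carrier R" if "x \<in> carrier Q" for x
    using g that by (auto simp: mod_hom_def self_module_simps)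
  have "(\<lambda>p. g (\<zero>, \<zero>, p)) \<in> mod_hom R P (self_module R)"
    using g_add[of "(\<zero>, \<zero>, _)" "(\<zero>, \<zero>, _)"] g_smult[of _ "(\<zero>, \<zero>, _)"] g_R
    by (auto simp: mod_hom_def self_module_simps hyp_module_simps)
  then obtain z where z: "z \<in> carrier P" "\<And>p. p \<in> carrier P \<Longrightarrow> B z p = g (\<zero>, \<zero>, p)"
    using P.nondegenerate_representation[OF nondegenerate] by metis
  obtain a b p where abp: "u = (a, b, p)" "a \<in> carrier R" "b \<in> carrier R" "p \<in> carrier P"
    using u by (auto simp: hyp_module_simps)
  let ?e = "(\<one>, \<zero>, \<zero>\<^bsub>P\<^esub>)" and ?f = "(\<zero>, \<one>, \<zero>\<^bsub>P\<^esub>)"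
  have u_eq: "u = a \<odot>\<^bsub>Q\<^esub> ?e \<oplus>\<^bsub>Q\<^esub> (b \<odot>\<^bsub>Q\<^esub> ?f \<oplus>\<^bsub>Q\<^esub> (\<zero>, \<zero>, p))"
    using abp by (simp add: hyp_module_simps)
  have "(\<zero>, \<zero>, p) \<in> carrier Q"
    using abp by (simp add: hyp_module_simps)
  then have g_expand: "g u = a \<otimes> g ?e \<oplus> (b \<otimes> g ?f \<oplus> g (\<zero>, \<zero>, p))"
    using abp(2,3) by (subst u_eq) (simp add: g_add g_smult)
  let ?z = "(g ?f, \<ominus> g ?e, z)"
  have zQ: "?z \<in> carrier Q"
    using z g_R by (simp add: hyp_module_simps)
  have "BQ ?z u = \<one>"
    using abp z(2)[OF abp(4)] g_R[of ?e] g_R[of ?f] g_R[of "(\<zero>, \<zero>, p)"] gu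
    by (simp add: hyp_form_def g_expand[unfolded abp(1)] P.R.minus_eq P.R.l_minus P.R.r_minus P.R.m_ac P.R.a_ac hyp_module_simps)
  then have "BQ u (\<ominus>\<^bsub>Q\<^esub> ?z) = \<one>"
    using zQ u Q.form_skew[of ?z u] by (simp add: Q.form_minus_right)
  then show ?thesis
    using zQ by blast
qed

lemma ideal_smult_embedding:
  assumes I: "ideal I R" and "q \<in> ideal_smult P I"
  shows "(\<zero>, \<zero>, q) \<in> ideal_smult Q I"
  using assms
proof (induction rule: P.ideal_smult_induct)
  case zero
  show ?case
    using Q.ideal_smult_zero by (simp add: hyp_module_simps)
next
  case (scaled c x)
  then show ?case
    using Q.ideal_smult_mult[of c I "(\<zero>, \<zero>, x)"] ideal.Icarr[OF I] by (simp add: hyp_module_simps)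
next
  case (add x y)
  then show ?case
    using Q.ideal_smult_add[OF add.IH] by (simp add: hyp_module_simps)
qed

text \<open>
  The elementary transvections are transvections along the unimodular vectors \<open>(0, 1, 0)\<close> and \<open>(1, 0, 0)\<close>;
  for \<open>\<mu>(q, \<beta>)\<close> the second vector is \<open>- q\<close>.
\<close>
lemma ETrans_Sp_generators:
  assumes "ideal I R"
  shows "{elem_rho R P B q \<alpha> | q \<alpha>. q \<in> ideal_smult P I \<and> \<alpha> \<in> I} \<union>
      {elem_mu R P B q \<beta> | q \<beta>. q \<in> ideal_smult P I \<and> \<beta> \<in> I} \<subseteq>
    {Q.T u v \<alpha> | u v \<alpha>. \<alpha> \<in> I \<and> u \<in> carrier Q \<and> v \<in> ideal_smult Q I \<and> BQ u v = \<zero> \<and>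
        (unimodular R Q u \<or> unimodular R Q v)}"
proof -
  let ?e = "(\<one>, \<zero>, \<zero>\<^bsub>P\<^esub>)" and ?f = "(\<zero>, \<one>, \<zero>\<^bsub>P\<^esub>)"
  have "(\<lambda>(a, b, p). a) \<in> mod_hom R Q (self_module R)" "(\<lambda>(a, b, p). b) \<in> mod_hom R Q (self_module R)"
    by (auto simp: mod_hom_def self_module_simps hyp_module_simps)
  from this[THEN rev_bexI] have unimod: "unimodular R Q ?e" "unimodular R Q ?f"
    by (simp_all add: unimodular_def)
  have perp: "BQ ?e (\<zero>, \<zero>, q) = \<zero>" "BQ ?f (\<zero>, \<zero>, q) = \<zero>" if "q \<in> carrier P" for q
    using that by (simp_all add: hyp_form_def P.R.minus_eq)
  have minus: "\<ominus>\<^bsub>P\<^esub> q \<in> ideal_smult P I" if "q \<in> ideal_smult P I" for q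
  proof -
    have "{i \<odot>\<^bsub>P\<^esub> x | i x. i \<in> I \<and> x \<in> carrier P} \<subseteq> carrier P"
      using ideal.Icarr[OF assms] by auto
    from P.M.add.generate_m_inv_closed[OF this, of q] show ?thesis
      using that by (simp add: ideal_smult_def a_inv_def)
  qed
  note closed = P.ideal_smult_carrier[OF assms] ideal.Icarr[OF assms]
  have "elem_rho R P B q \<alpha> = Q.T ?f (\<zero>, \<zero>, q) \<alpha> \<and> (\<zero>, \<zero>, q) \<in> ideal_smult Q I \<and> BQ ?f (\<zero>, \<zero>, q) = \<zero>"
    if "q \<in> ideal_smult P I" "\<alpha> \<in> I" for q \<alpha>
    using that closed elem_rho_eq ideal_smult_embedding[OF assms] perp by auto
  moreover have "elem_mu R P B q \<alpha> = Q.T ?e (\<zero>, \<zero>, \<ominus>\<^bsub>P\<^esub> q) \<alpha> \<and> (\<zero>, \<zero>, \<ominus>\<^bsub>P\<^esub> q) \<in> ideal_smult Q I \<and>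
      BQ ?e (\<zero>, \<zero>, \<ominus>\<^bsub>P\<^esub> q) = \<zero>"
    if "q \<in> ideal_smult P I" "\<alpha> \<in> I" for q \<alpha>
    using that closed elem_mu_eq ideal_smult_embedding[OF assms minus] perp by auto
  ultimately show ?thesis
    using unimod Q.e_closed Q.f_closed by blast
qed

text \<open>Facts about \<open>ETrans(IQ)\<close> thus specialize to \<open>ETrans(Q)\<close>.\<close>
lemma ETrans_Sp_eq_ideal: "ETrans_Sp R P B = ETrans_Sp_ideal R P B (carrier R)"
proof -
  have "ideal_smult P (carrier R) = carrier P"
  proof
    show "ideal_smult P (carrier R) \<subseteq> carrier P"
      using P.ideal_smult_carrier[OF P.R.oneideal] by auto
    show "carrier P \<subseteq> ideal_smult P (carrier R)"
      using P.ideal_smult_mult[OF P.R.one_closed] by auto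
  qed
  then show ?thesis
    by (simp add: ETrans_Sp_def ETrans_Sp_ideal_def)
qed

lemma ETrans_Sp_ideal_subset_Trans:
  assumes "ideal I R"
  shows "ETrans_Sp_ideal R P B I \<subseteq> Trans_Sp R Q BQ I"
  unfolding ETrans_Sp_ideal_def Trans_Sp_def
  by (rule Q.Aut.mono_generate[OF ETrans_Sp_generators[OF assms]])

lemma elementary_in_ETrans_Sp_ideal:
  assumes "ideal I R" "ETrans_Sp_ideal R P B I \<subseteq> N"
  shows "Q.elementary_in I N"
  unfolding Q.elementary_in_def complement_eq
proof (clarsimp simp: hyp_module_simps, intro conjI)
  fix p c d assume "p \<in> carrier P" and c: "c \<in> I" and d: "d \<in> I"
  moreover have cR: "c \<in> carrier R" "d \<in> carrier R" "\<ominus> c \<in> I"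
    using c d ideal.Icarr[OF assms(1)] additive_subgroup.a_inv_closed[OF ideal.axioms(1)[OF assms(1)]]
    by auto
  ultimately have "c \<odot>\<^bsub>P\<^esub> p \<in> ideal_smult P I" "\<ominus> c \<odot>\<^bsub>P\<^esub> p \<in> ideal_smult P I"
    by (simp_all only: P.ideal_smult_mult)
  then have "elem_rho R P B (c \<odot>\<^bsub>P\<^esub> p) d \<in> ETrans_Sp_ideal R P B I"
    "elem_mu R P B (\<ominus> c \<odot>\<^bsub>P\<^esub> p) d \<in> ETrans_Sp_ideal R P B I"
    unfolding ETrans_Sp_ideal_def using d by (blast intro: generate.incl)+
  then have "elem_rho R P B (c \<odot>\<^bsub>P\<^esub> p) d \<in> N" "elem_mu R P B (\<ominus> c \<odot>\<^bsub>P\<^esub> p) d \<in> N"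
    using assms(2) by auto
  then show "Q.T (\<one>, \<zero>, \<zero>\<^bsub>P\<^esub>) (c \<otimes> \<zero>, c \<otimes> \<zero>, c \<odot>\<^bsub>P\<^esub> p) d \<in> N"
     "Q.T (\<zero>, \<one>, \<zero>\<^bsub>P\<^esub>) (c \<otimes> \<zero>, c \<otimes> \<zero>, c \<odot>\<^bsub>P\<^esub> p) d \<in> N"
    using \<open>p \<in> carrier P\<close> cR by (simp_all add: elem_rho_eq elem_mu_eq P.smult_l_minus)
qed

end

theorem theorem5p23:
  fixes R :: "('a, 'l) ring_scheme"
    and P :: "('a, 'b, 'm) module_scheme"
    and form :: "'b \<Rightarrow> 'b \<Rightarrow> 'a"
    and I :: "'a set"
    and n :: nat
  assumes "cring R"
    and "carrier R = (\<lambda>r. (\<one>\<^bsub>R\<^esub> \<oplus>\<^bsub>R\<^esub> \<one>\<^bsub>R\<^esub>) \<otimes>\<^bsub>R\<^esub> r) ` carrier R"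
    and "ideal I R"
    and "symplectic_module R P form"
    and "n \<ge> 1"
    and "has_rank R P (2 * n)"
    and "\<And>\<mm>. maximalideal \<mm> R \<Longrightarrow>
           \<exists>e \<phi>. mod_basis (ring_at R \<mm>) (module_at R P \<mm>) (2 * n) e \<and>
             form_matrix (ring_at R \<mm>) (module_at R P \<mm>) (form_at R form \<mm>) (2 * n) e \<phi> \<and>
             alternating_matrix (ring_at R \<mm>) (2 * n) \<phi> \<and>
             pfaffian (ring_at R \<mm>) n \<phi> = \<one>\<^bsub>ring_at R \<mm>\<^esub> \<and>
             matrix_cong (ring_at R \<mm>) (ideal_at R I \<mm>) (2 * n) \<phi> (psi_matrix (ring_at R \<mm>) n)"
  shows "Trans_Sp R (hyp_module R P) (hyp_form R form) I = ETrans_Sp_rel R P form I"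
proof -
  interpret symplectic_sum R P form
    using assms(4)
    by (simp add: symplectic_sum_def symplectic_sum_axioms_def symplectic_module_def fg_projective_def
        alternating_module_def alternating_module_axioms_def)
  let ?Trans = "Trans_Sp R Q BQ I" and ?E = "ETrans_Sp R P form" and ?EI = "ETrans_Sp_ideal R P form I"
  let ?AE = "Q.A\<lparr>carrier := ?E\<rparr>"
  obtain half where half: "half \<in> carrier R" "(\<one>\<^bsub>R\<^esub> \<oplus>\<^bsub>R\<^esub> \<one>\<^bsub>R\<^esub>) \<otimes>\<^bsub>R\<^esub> half = \<one>\<^bsub>R\<^esub>"
    using assms(2) P.R.one_closed by (metis imageE)
  have gens: "{Q.T u v \<alpha> | u v \<alpha>. \<alpha> \<in> J \<and> u \<in> carrier Q \<and> v \<in> ideal_smult Q J \<and> BQ u v = \<zero>\<^bsub>R\<^esub> \<and>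
        (unimodular R Q u \<or> unimodular R Q v)} \<subseteq> Q.isometries" if "ideal J R" for J
    using Q.ideal_smult_carrier[OF that] ideal.Icarr[OF that] by (auto intro!: Q.transvection_isometry)
  have isometries: "Q.isometries \<subseteq> carrier Q.A"
    by (auto simp: Q.isometries_def)
  note E_gens = subset_trans[OF ETrans_Sp_generators[OF P.R.oneideal] gens[OF P.R.oneideal]]
  have E_subgroup: "subgroup ?E Q.A"
    unfolding ETrans_Sp_eq_ideal ETrans_Sp_ideal_def
    by (rule Q.Aut.generate_is_subgroup[OF subset_trans[OF E_gens isometries]])
  have E_isometries: "?E \<subseteq> Q.isometries"
    unfolding ETrans_Sp_eq_ideal ETrans_Sp_ideal_def
    by (rule Q.Aut.generate_subgroup_incl[OF E_gens Q.isometries_subgroup])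
  interpret E: group ?AE
    by (rule Q.Aut.subgroup_imp_group[OF E_subgroup])
  show ?thesis
  proof
    show "?Trans \<subseteq> ETrans_Sp_rel R P form I"
      unfolding ETrans_Sp_rel_def normal_closure_def
    proof (intro Inter_greatest)
      fix N assume "N \<in> {N. N \<lhd> ?AE \<and> ?EI \<subseteq> N}"
      then have N: "N \<lhd> ?AE" "?EI \<subseteq> N"
        by auto
      have N_subgroup: "subgroup N Q.A"
        using Q.Aut.incl_subgroup[OF E_subgroup] normal_imp_subgroup[OF N(1)] .
      interpret full_elementary_normal R Q BQ "(\<one>\<^bsub>R\<^esub>, \<zero>\<^bsub>R\<^esub>, \<zero>\<^bsub>P\<^esub>)" "(\<zero>\<^bsub>R\<^esub>, \<one>\<^bsub>R\<^esub>, \<zero>\<^bsub>P\<^esub>)" ?E N I half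
      proof (intro full_elementary_normal.intro elementary_normal.intro Q.hyperbolic_pair_axioms
          elementary_normal_axioms.intro full_elementary_normal_axioms.intro half E_subgroup N_subgroup assms(3))
        show "g \<otimes>\<^bsub>Q.A\<^esub> x \<otimes>\<^bsub>Q.A\<^esub> inv\<^bsub>Q.A\<^esub> g \<in> N" if "g \<in> ?E" "x \<in> N" for g x
          using E.normal_invE(2)[OF N(1), of g x] Q.Aut.m_inv_consistent[OF E_subgroup, of g] that by simp
        show "Q.elementary_in (carrier R) ?E"
          by (rule elementary_in_ETrans_Sp_ideal[OF P.R.oneideal]) (simp add: ETrans_Sp_eq_ideal)
        show "Q.elementary_in I N"
          by (rule elementary_in_ETrans_Sp_ideal[OF assms(3) N(2)])
        have "{BQ p q | p q. p \<in> Q.complement \<and> q \<in> Q.complement} =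
            {form p q | p q. p \<in> carrier P \<and> q \<in> carrier P}"
          using form_complement by (auto simp: complement_eq) metis+
        then show "\<one>\<^bsub>R\<^esub> \<in> genideal R {BQ p q | p q. p \<in> Q.complement \<and> q \<in> Q.complement}"
          using form_ideal_of_positive_rank[OF assms(1,4,6)] assms(5) by simp
      qed
      show "?Trans \<subseteq> N"
        unfolding Trans_Sp_def
        using unimodular_pairing by (intro Q.Aut.generate_subgroup_incl N_subgroup)
          (auto intro!: transvection_in_normal)
    qed
    \<comment> \<open>Isometries normalize \<open>Trans\<close>, so its intersection with \<open>ETrans\<close> is normal in \<open>ETrans\<close>.\<close>
    let ?N = "?Trans \<inter> ?E"
    have isometry_group: "group (Q.A\<lparr>carrier := Q.isometries\<rparr>)"
      by (rule Q.Aut.subgroup_imp_group[OF Q.isometries_subgroup])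
    have "subgroup ?E (Q.A\<lparr>carrier := Q.isometries\<rparr>)"
      by (rule Q.Aut.subgroup_incl[OF E_subgroup Q.isometries_subgroup E_isometries])
    from group.normal_Int_subgroup[OF isometry_group this Q.Trans_Sp_normal[OF assms(3)]]
    have "?N \<lhd> ?AE"
      by simp
    moreover have "?EI \<subseteq> ?E"
      unfolding ETrans_Sp_eq_ideal ETrans_Sp_ideal_def
    proof (rule Q.Aut.mono_generate)
      have "ideal_smult P I \<subseteq> ideal_smult P (carrier R)"
        unfolding ideal_smult_def using ideal.Icarr[OF assms(3)] by (intro P.M.add.mono_generate) auto
      then show "{elem_rho R P form q \<alpha> | q \<alpha>. q \<in> ideal_smult P I \<and> \<alpha> \<in> I} \<union>
          {elem_mu R P form q \<beta> | q \<beta>. q \<in> ideal_smult P I \<and> \<beta> \<in> I} \<subseteq>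
        {elem_rho R P form q \<alpha> | q \<alpha>. q \<in> ideal_smult P (carrier R) \<and> \<alpha> \<in> carrier R} \<union>
          {elem_mu R P form q \<beta> | q \<beta>. q \<in> ideal_smult P (carrier R) \<and> \<beta> \<in> carrier R}"
        using ideal.Icarr[OF assms(3)] by blast
    qed
    ultimately have "ETrans_Sp_rel R P form I \<subseteq> ?N"
      unfolding ETrans_Sp_rel_def normal_closure_def
      using ETrans_Sp_ideal_subset_Trans[OF assms(3)] by auto
    then show "ETrans_Sp_rel R P form I \<subseteq> ?Trans"
      by auto
  qed
qed

end
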